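(* Let $\mathcal{A}$ be a set containing $0$ and $1$, and let $(p_a)_{a\in\mathcal{A}}$ be a fixed probability distribution on $\mathcal{A}$ (not depending on $n$) with $p_0>0$ and $p_1>0$. For each $n\ge 1$ let $X=X_n=(x_{ij})_{i,j=1}^n$ be a random $n\times n$ matrix whose entries are independent and identically distributed with $\mathbb{P}(x_{ij}=a)=p_a$ for $a\in\mathcal{A}$. Let $Q=1/p_0>1$, and let $T^*_n$ be any one of the four random variables $T_n$, $T^{\mathrm{s}}_n$, $T^{\mathrm{p}}_n$, $T^{\mathrm{ps}}_n$ (the maximal size of, respectively, a triangular submatrix, a special triangular submatrix, a triangular permuted submatrix, and a special triangular permuted submatrix of $X_n$). Then, as $n\to\infty$, $$\frac{T^*_n}{\log_Q n}\longrightarrow 2+\sqrt{2}\quad\text{in probability},$$ that is, for every $\varepsilon>0$, $$\mathbb{P}\bigl((2+\sqrt2-\varepsilon)\log_Q n<T^*_n<(2+\sqrt2+\varepsilon)\log_Q n\bigr)\to 1\quad\text{as } n\to\infty.$$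
   Context: A submatrix of a matrix $(a_{ij})_{i\in M,j\in N}$ is a matrix $(a_{ij})_{i\in I,j\in J}$ with $\emptyset\ne I\subseteq M$ and $\emptyset\neq J\subseteq N$, where the order of the rows and of the columns is preserved. A permuted submatrix of $(a_{ij})$ is a matrix $(a_{i_rj_s})_{1\le r\le k,\,1\le s\le \ell}$ for a sequence of distinct rows $i_1,\dots,i_k$ and a sequence of distinct columns $j_1,\dots,j_\ell$ (in arbitrary orders). A (lower) triangular matrix is a square matrix $(a_{ij})_{i,j=1}^m$ such that $a_{ij}=0$ whenever $i<j$. A special triangular matrix is a square matrix $(a_{ij})_{i,j=1}^m$ such that $a_{ij}=0$ whenever $i<j$ and $a_{ii}=1$ for all $i$; the remaining entries are arbitrary. The size of a square matrix is its number of rows. For the random matrix $X=X_n$: $T_n$ is the maximal size of a submatrix of $X$ that is triangular; $T^{\mathrm{s}}_n$ is the maximal size of a submatrix of $X$ that is special triangular; $T^{\mathrm{p}}_n$ is the maximal size of a permuted submatrix of $X$ that is triangular; $T^{\mathrm{ps}}_n$ is the maximal size of a permuted submatrix of $X$ that is special triangular. (If no such submatrix exists, the maximal size is taken to be $0$.) $\log_Q n=\log n/\log Q$, with $\log$ the natural logarithm. *)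

theory Defs
  imports "HOL-Probability.Probability" "Jordan_Normal_Form.DL_Submatrix"
begin

(* Rows and columns of an m x m matrix are indexed by 0, ..., m-1. *)

definition is_submatrix :: "'a mat \<Rightarrow> 'a mat \<Rightarrow> bool" where
  "is_submatrix B A \<longleftrightarrow>
    (\<exists>I J. I \<noteq> {} \<and> I \<subseteq> {..<dim_row A} \<and> J \<noteq> {} \<and> J \<subseteq> {..<dim_col A} \<and> B = submatrix A I J)"

definition is_permuted_submatrix :: "'a mat \<Rightarrow> 'a mat \<Rightarrow> bool" where
  "is_permuted_submatrix B A \<longleftrightarrow>
    (\<exists>rs cs. rs \<noteq> [] \<and> distinct rs \<and> set rs \<subseteq> {..<dim_row A} \<and>
             cs \<noteq> [] \<and> distinct cs \<and> set cs \<subseteq> {..<dim_col A} \<and>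
             B = mat (length rs) (length cs) (\<lambda>(r, s). A $$ (rs ! r, cs ! s)))"

definition triangular :: "'a::zero mat \<Rightarrow> bool" where
  "triangular B \<longleftrightarrow>
    square_mat B \<and> (\<forall>i<dim_row B. \<forall>j<dim_col B. i < j \<longrightarrow> B $$ (i, j) = 0)"

definition special_triangular :: "'a::{zero,one} mat \<Rightarrow> bool" where
  "special_triangular B \<longleftrightarrow> triangular B \<and> (\<forall>i<dim_row B. B $$ (i, i) = 1)"

(* Inserting 0 implements the convention that the maximal size is 0 if there is no matrix
   satisfying P. In the four uses below the set of sizes is bounded by dim_row A, hence finite,
   so Max is the genuine maximum. *)
definition max_size :: "('a mat \<Rightarrow> bool) \<Rightarrow> nat" where
  "max_size P = Max (insert 0 {dim_row B | B. P B})"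

definition T_tri :: "'a::zero mat \<Rightarrow> nat" where
  "T_tri A = max_size (\<lambda>B. is_submatrix B A \<and> triangular B)"

definition T_special :: "'a::{zero,one} mat \<Rightarrow> nat" where
  "T_special A = max_size (\<lambda>B. is_submatrix B A \<and> special_triangular B)"

definition T_perm :: "'a::zero mat \<Rightarrow> nat" where
  "T_perm A = max_size (\<lambda>B. is_permuted_submatrix B A \<and> triangular B)"

definition T_perm_special :: "'a::{zero,one} mat \<Rightarrow> nat" where
  "T_perm_special A = max_size (\<lambda>B. is_permuted_submatrix B A \<and> special_triangular B)"

(* The n-th variable may live on its own probability space M n; the limit is a constant. *)
definition converges_in_probability ::
    "(nat \<Rightarrow> 'w measure) \<Rightarrow> (nat \<Rightarrow> 'w \<Rightarrow> real) \<Rightarrow> real \<Rightarrow> bool" where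
  "converges_in_probability M Y c \<longleftrightarrow>
    (\<forall>\<epsilon>>0. (\<lambda>n. measure (M n) {\<omega> \<in> space (M n). \<bar>Y n \<omega> - c\<bar> > \<epsilon>}) \<longlonglongrightarrow> 0)"

(* X is an n x n matrix whose entries are i.i.d. random elements of the discrete space A
   with distribution p (a probability mass function supported in A). *)
definition iid_random_matrix ::
    "'w measure \<Rightarrow> nat \<Rightarrow> 'a set \<Rightarrow> 'a pmf \<Rightarrow> ('w \<Rightarrow> 'a mat) \<Rightarrow> bool" where
  "iid_random_matrix M n A p X \<longleftrightarrow>
    prob_space M \<and>
    (\<forall>\<omega>\<in>space M. X \<omega> \<in> carrier_mat n n) \<and>
    prob_space.indep_vars M (\<lambda>_. count_space A) (\<lambda>ij \<omega>. X \<omega> $$ ij) ({..<n} \<times> {..<n}) \<and>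
    (\<forall>i<n. \<forall>j<n. \<forall>a\<in>A. measure M {\<omega> \<in> space M. X \<omega> $$ (i, j) = a} = pmf p a)"

end

theory Submission
  imports Defs "HOL-Real_Asymp.Real_Asymp"
begin

text \<open>
  Write \<open>c = 2 + sqrt 2\<close> and \<open>L = log Q n\<close>. All four variables lie between the one for special
  triangular submatrices and the one for triangular permuted submatrices.

  For the upper bound, the first moment of triangular permuted submatrices themselves is too
  large (it would give the constant 4). Instead one counts a sparser pattern: of a triangular
  matrix of size \<open>m\<close> keep only the first \<open>k\<close> rows and the last \<open>k\<close> columns. This pattern has
  \<open>k\<^sup>2 - (2 k - m) (2 k - m + 1) / 2\<close> prescribed zeros and at most \<open>n ^ (2 k)\<close> positions, and the
  choice \<open>k = m / sqrt 2\<close> is optimal and makes the first moment tend to 0 once \<open>m \<ge> (c + \<epsilon>) L\<close>.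

  For the lower bound, cut rows and columns into \<open>m\<close> consecutive blocks of length \<open>K\<close> and choose
  the \<open>i\<close>-th row and the \<open>i\<close>-th column from the \<open>i\<close>-th blocks. Two such choices that agree on the
  row indices \<open>A\<close> and the column indices \<open>B\<close> share at most \<open>(card A + card B) m / c\<close> prescribed
  zeros, again by optimising over \<open>card A + card B\<close>; so the normalised second moment is at most
  \<open>(1 + \<theta> / K) ^ (2 m)\<close> with \<open>\<theta> = Q powr (m / c) / p\<^sub>1\<close>, which tends to 1 if \<open>m \<le> (c - \<epsilon>) L + 1\<close>.
\<close>

section \<open>Triangular submatrices in terms of index lists\<close>

text \<open>Exactly \<open>i\<close> elements of a strictly increasing list lie below the entry at
  position \<open>i\<close>, and \<open>pick\<close> selects an element of a set by its number of
  smaller elements.\<close>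

lemma pick_set_nth:
  assumes "sorted_wrt (<) xs" "i < length xs"
  shows "pick (set xs) i = xs ! i"
proof -
  have mono: "xs ! k < xs ! l \<longleftrightarrow> k < l" if "k < length xs" "l < length xs" for k l
    using assms(1) that unfolding sorted_wrt_iff_nth_less
    by (metis not_less_iff_gr_or_eq)
  have "{a \<in> set xs. a < xs ! i} = (!) xs ` {k. k < length xs \<and> xs ! k < xs ! i}"
    by (auto simp: set_conv_nth)
  also have "{k. k < length xs \<and> xs ! k < xs ! i} = {..<i}"
    using assms(2) mono by auto
  finally have "{a \<in> set xs. a < xs ! i} = (!) xs ` {..<i}" .
  moreover have "inj_on ((!) xs) {..<i}"
    using assms by (intro inj_on_nth) (auto simp: strict_sorted_iff)
  ultimately have "card {a \<in> set xs. a < xs ! i} = i"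
    by (simp add: card_image)
  then show ?thesis
    using pick_card_in_set[of "xs ! i" "set xs"] assms(2) by simp
qed

text \<open>One predicate serves all four variables: \<open>ordered\<close> is
  \<open>sorted_wrt (<)\<close> for submatrices and \<open>distinct\<close> for permuted ones, and
  \<open>special\<close> switches on the condition on the diagonal.\<close>

definition tri_index :: "(nat list \<Rightarrow> bool) \<Rightarrow> bool \<Rightarrow> 'a::{zero,one} mat \<Rightarrow> nat list \<Rightarrow> nat list \<Rightarrow> bool"
  where "tri_index ordered special A rs cs \<longleftrightarrow>
    ordered rs \<and> ordered cs \<and> length cs = length rs \<and>
    set rs \<subseteq> {..<dim_row A} \<and> set cs \<subseteq> {..<dim_col A} \<and>
    (\<forall>i<length rs. \<forall>j<length rs. i < j \<longrightarrow> A $$ (rs ! i, cs ! j) = 0) \<and>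
    (special \<longrightarrow> (\<forall>i<length rs. A $$ (rs ! i, cs ! i) = 1))"

text \<open>The bound \<open>b\<close> makes the set of sizes finite, so that \<open>Max\<close> is
  meaningful; \<open>0 < t\<close> excludes the default size 0 as a witness.\<close>

lemma le_max_size_iff:
  assumes "\<And>B. P B \<Longrightarrow> dim_row B \<le> b" "0 < t"
  shows "t \<le> max_size P \<longleftrightarrow> (\<exists>B. P B \<and> t \<le> dim_row B)"
proof -
  have "{dim_row B |B. P B} \<subseteq> {..b}"
    using assms(1) by auto
  then have "finite {dim_row B |B. P B}"
    using finite_subset by blast
  then show ?thesis
    unfolding max_size_def using assms(2) by (subst Max_ge_iff) auto
qed

lemma length_distinct_le:
  assumes "distinct xs" "set xs \<subseteq> {..<n::nat}"
  shows "length xs \<le> n"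
  using card_mono[OF _ assms(2)] distinct_card[OF assms(1)] by simp

text \<open>A finite index set and its increasing enumeration determine each other. Submatrices
  thereby get the form of \<open>is_permuted_submatrix_def\<close> with \<open>distinct\<close>
  replaced by \<open>sorted_wrt (<)\<close>, so that both kinds can be treated together.\<close>

lemma is_submatrix_conv_lists:
  "is_submatrix B A \<longleftrightarrow>
    (\<exists>rs cs. rs \<noteq> [] \<and> sorted_wrt (<) rs \<and> set rs \<subseteq> {..<dim_row A} \<and>
             cs \<noteq> [] \<and> sorted_wrt (<) cs \<and> set cs \<subseteq> {..<dim_col A} \<and>
             B = mat (length rs) (length cs) (\<lambda>(r, s). A $$ (rs ! r, cs ! s)))"
proof
  assume "is_submatrix B A"
  then obtain I J where I: "I \<noteq> {}" "I \<subseteq> {..<dim_row A}" and J: "J \<noteq> {}" "J \<subseteq> {..<dim_col A}"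
    and B: "B = submatrix A I J"
    unfolding is_submatrix_def by blast
  have eq: "{i. i < dim_row A \<and> i \<in> I} = I" "{j. j < dim_col A \<and> j \<in> J} = J"
    using I J by auto
  have fin: "finite I" "finite J"
    using I J finite_subset by blast+
  define l where "l K = map (pick K) [0..<card K]" for K
  have l: "l K \<noteq> []" "sorted_wrt (<) (l K)" "set (l K) \<subseteq> K" "length (l K) = card K"
    if "finite K" "K \<noteq> {}" for K
    using that pick_mono_le pick_in_set_le by (auto simp: l_def sorted_wrt_iff_nth_less)
  have "B = mat (length (l I)) (length (l J)) (\<lambda>(r, s). A $$ (l I ! r, l J ! s))"
    unfolding B submatrix_def eq by (rule eq_matI) (auto simp: l_def)
  then show "\<exists>rs cs. rs \<noteq> [] \<and> sorted_wrt (<) rs \<and> set rs \<subseteq> {..<dim_row A} \<and>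
             cs \<noteq> [] \<and> sorted_wrt (<) cs \<and> set cs \<subseteq> {..<dim_col A} \<and>
             B = mat (length rs) (length cs) (\<lambda>(r, s). A $$ (rs ! r, cs ! s))"
    using l[OF fin(1) I(1)] l[OF fin(2) J(1)] order.trans[OF l(3) I(2)] order.trans[OF l(3) J(2)] fin I J
    by (intro exI[of _ "l I"] exI[of _ "l J"] conjI) simp_all
next
  assume "\<exists>rs cs. rs \<noteq> [] \<and> sorted_wrt (<) rs \<and> set rs \<subseteq> {..<dim_row A} \<and>
             cs \<noteq> [] \<and> sorted_wrt (<) cs \<and> set cs \<subseteq> {..<dim_col A} \<and>
             B = mat (length rs) (length cs) (\<lambda>(r, s). A $$ (rs ! r, cs ! s))"
  then obtain rs cs where rs: "rs \<noteq> []" "sorted_wrt (<) rs" "set rs \<subseteq> {..<dim_row A}"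
    and cs: "cs \<noteq> []" "sorted_wrt (<) cs" "set cs \<subseteq> {..<dim_col A}"
    and B: "B = mat (length rs) (length cs) (\<lambda>(r, s). A $$ (rs ! r, cs ! s))"
    by blast
  have eq: "{i. i < dim_row A \<and> i \<in> set rs} = set rs" "{j. j < dim_col A \<and> j \<in> set cs} = set cs"
    using rs cs by auto
  have "card (set rs) = length rs" "card (set cs) = length cs"
    using rs(2) cs(2) by (simp_all add: distinct_card strict_sorted_iff)
  then have "B = submatrix A (set rs) (set cs)"
    unfolding B submatrix_def eq using rs(2) cs(2) by (intro eq_matI) (auto simp: pick_set_nth)
  then show "is_submatrix B A"
    using rs cs unfolding is_submatrix_def by blast
qed

text \<open>Stated for abstract \<open>sub\<close> and \<open>ordered\<close> so that one proof
  covers the four variables. The entries of a matrix given by two index lists translate directly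
  into the conditions of \<open>tri_index\<close>.\<close>

lemma le_max_size_tri_iff:
  assumes sub: "\<And>B. sub B \<longleftrightarrow>
      (\<exists>rs cs. rs \<noteq> [] \<and> ordered rs \<and> set rs \<subseteq> {..<dim_row A} \<and>
               cs \<noteq> [] \<and> ordered cs \<and> set cs \<subseteq> {..<dim_col A} \<and>
               B = mat (length rs) (length cs) (\<lambda>(r, s). A $$ (rs ! r, cs ! s)))"
    and ordered: "\<And>xs. ordered xs \<Longrightarrow> distinct xs"
    and "0 < t"
  shows "t \<le> max_size (\<lambda>B. sub B \<and> triangular B \<and> (special \<longrightarrow> (\<forall>i<dim_row B. B $$ (i, i) = 1)))
     \<longleftrightarrow> (\<exists>rs cs. tri_index ordered special A rs cs \<and> t \<le> length rs)" (is "t \<le> max_size ?P \<longleftrightarrow> ?R")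
proof -
  define S where "S rs cs = mat (length rs) (length cs) (\<lambda>(r, s). A $$ (rs ! r, cs ! s))" for rs cs
  have dim_S: "dim_row (S rs cs) = length rs" for rs cs
    by (simp add: S_def)
  have tri_S: "triangular (S rs cs) \<longleftrightarrow>
      length cs = length rs \<and> (\<forall>i<length rs. \<forall>j<length rs. i < j \<longrightarrow> A $$ (rs ! i, cs ! j) = 0)"
    for rs cs
    by (auto simp: triangular_def S_def)
  have "t \<le> max_size ?P \<longleftrightarrow> (\<exists>B. ?P B \<and> t \<le> dim_row B)"
  proof (rule le_max_size_iff[OF _ \<open>0 < t\<close>])
    fix B
    assume "?P B"
    then obtain rs cs where "ordered rs" "set rs \<subseteq> {..<dim_row A}" "B = S rs cs"
      unfolding sub S_def by blast
    then show "dim_row B \<le> dim_row A"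
      using length_distinct_le ordered by (simp add: dim_S)
  qed
  also have "\<dots> \<longleftrightarrow> ?R"
  proof
    assume "\<exists>B. ?P B \<and> t \<le> dim_row B"
    then obtain B where B: "sub B" "triangular B"
        "special \<longrightarrow> (\<forall>i<dim_row B. B $$ (i, i) = 1)" "t \<le> dim_row B"
      by blast
    from B(1) obtain rs cs where "ordered rs" "set rs \<subseteq> {..<dim_row A}"
        "ordered cs" "set cs \<subseteq> {..<dim_col A}" and eq: "B = S rs cs"
      unfolding sub S_def by blast
    moreover have "length cs = length rs"
      "\<forall>i<length rs. \<forall>j<length rs. i < j \<longrightarrow> A $$ (rs ! i, cs ! j) = 0"
      using B(2) unfolding eq tri_S by auto
    ultimately show ?R
      using B(3,4) unfolding tri_index_def by (intro exI[of _ rs] exI[of _ cs]) (auto simp: S_def)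
  next
    assume ?R
    then obtain rs cs where rs: "tri_index ordered special A rs cs" "t \<le> length rs"
      by blast
    then have "rs \<noteq> []" "cs \<noteq> []"
      using \<open>0 < t\<close> by (auto simp: tri_index_def)
    then have "sub (S rs cs)"
      using rs unfolding sub tri_index_def S_def by blast
    moreover have "triangular (S rs cs)"
      using rs unfolding tri_S tri_index_def by blast
    moreover have "special \<longrightarrow> (\<forall>i<dim_row (S rs cs). S rs cs $$ (i, i) = 1)"
      using rs by (auto simp: tri_index_def S_def)
    ultimately show "\<exists>B. ?P B \<and> t \<le> dim_row B"
      using rs(2) dim_S by metis
  qed
  finally show ?thesis .
qed

lemma le_T_iff:
  assumes "0 < t"
  shows le_T_tri_iff: "t \<le> T_tri A \<longleftrightarrow>
      (\<exists>rs cs. tri_index (sorted_wrt (<)) False A rs cs \<and> t \<le> length rs)"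
    and le_T_special_iff: "t \<le> T_special A \<longleftrightarrow>
      (\<exists>rs cs. tri_index (sorted_wrt (<)) True A rs cs \<and> t \<le> length rs)"
    and le_T_perm_iff: "t \<le> T_perm A \<longleftrightarrow>
      (\<exists>rs cs. tri_index distinct False A rs cs \<and> t \<le> length rs)"
    and le_T_perm_special_iff: "t \<le> T_perm_special A \<longleftrightarrow>
      (\<exists>rs cs. tri_index distinct True A rs cs \<and> t \<le> length rs)"
proof -
  have sorted: "distinct xs" if "sorted_wrt (<) xs" for xs :: "nat list"
    using that strict_sorted_iff by blast
  note sub = le_max_size_tri_iff[OF is_submatrix_conv_lists sorted assms]
    and perm = le_max_size_tri_iff[OF is_permuted_submatrix_def _ assms]
  show "t \<le> T_tri A \<longleftrightarrow> (\<exists>rs cs. tri_index (sorted_wrt (<)) False A rs cs \<and> t \<le> length rs)"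
    using sub[of A False] by (simp add: T_tri_def)
  show "t \<le> T_special A \<longleftrightarrow> (\<exists>rs cs. tri_index (sorted_wrt (<)) True A rs cs \<and> t \<le> length rs)"
    using sub[of A True] by (simp add: T_special_def special_triangular_def)
  show "t \<le> T_perm A \<longleftrightarrow> (\<exists>rs cs. tri_index distinct False A rs cs \<and> t \<le> length rs)"
    using perm[of A False] by (simp add: T_perm_def)
  show "t \<le> T_perm_special A \<longleftrightarrow> (\<exists>rs cs. tri_index distinct True A rs cs \<and> t \<le> length rs)"
    using perm[of A True] by (simp add: T_perm_special_def special_triangular_def)
qed

text \<open>An increasing list is distinct, and dropping the diagonal condition keeps a witness
  valid, so a witness for \<open>T_special\<close> is one for each of the four variables.\<close>

lemma T_special_le:
  assumes "T \<in> {T_tri, T_special, T_perm, T_perm_special}"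
  shows "T_special A \<le> T A"
proof (cases "T_special A = 0")
  case False
  then obtain rs cs where rs: "tri_index (sorted_wrt (<)) True A rs cs" "T_special A \<le> length rs"
    using le_T_special_iff[of "T_special A" A] by auto
  then have "tri_index (sorted_wrt (<)) False A rs cs" "tri_index distinct False A rs cs"
    "tri_index distinct True A rs cs"
    by (auto simp: tri_index_def strict_sorted_iff)
  then show ?thesis
    using rs assms le_T_iff[of "T_special A" A] False by auto
qed simp

text \<open>Every kind of witness becomes one for \<open>T_perm\<close> once the order of the lists
  and the diagonal are forgotten.\<close>

lemma le_T_perm:
  assumes "T \<in> {T_tri, T_special, T_perm, T_perm_special}"
  shows "T A \<le> T_perm A"
proof (cases "T A = 0")
  case False
  have "\<exists>special rs cs. (tri_index (sorted_wrt (<)) special A rs cs \<or> tri_index distinct special A rs cs) \<and>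
      T A \<le> length rs"
    using assms
  proof (elim insertE emptyE)
    assume "T = T_tri"
    then show ?thesis
      using le_T_tri_iff[of "T A" A] False by auto
  next
    assume "T = T_special"
    then show ?thesis
      using le_T_special_iff[of "T A" A] False by auto
  next
    assume "T = T_perm"
    then show ?thesis
      using le_T_perm_iff[of "T A" A] False by auto
  next
    assume "T = T_perm_special"
    then show ?thesis
      using le_T_perm_special_iff[of "T A" A] False by auto
  qed
  then obtain special rs cs where rs: "T A \<le> length rs"
    and "tri_index (sorted_wrt (<)) special A rs cs \<or> tri_index distinct special A rs cs"
    by blast
  then have "tri_index distinct False A rs cs"
    by (auto simp: tri_index_def strict_sorted_iff)
  then show ?thesis
    using rs le_T_perm_iff[of "T A" A] False by blast
qed simp

section \<open>Counting cells of triangular patterns\<close>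

text \<open>With \<open>a\<close>, \<open>b\<close>, \<open>c\<close> the sizes of \<open>A\<close>,
  \<open>B\<close> and \<open>A \<inter> B\<close>, at least half of the pairs from
  \<open>A \<inter> B\<close> violate \<open>i < j\<close>, so the count is at most
  \<open>a * b - c\<^sup>2 / 2\<close>, where \<open>c \<ge> a + b - m\<close>. Maximising the ratio
  of this bound to \<open>a + b\<close> gives the constant. The count is the number of prescribed
  zeros shared by two block choices that agree on the rows \<open>A\<close> and the columns
  \<open>B\<close>.\<close>

lemma card_less_pairs_le:
  fixes A B :: "nat set"
  assumes "A \<subseteq> {..<m}" "B \<subseteq> {..<m}"
  shows "real (card {(i, j) \<in> A \<times> B. i < j}) \<le> (card A + card B) * (m / (2 + sqrt 2))"
proof -
  define C where "C = A \<inter> B"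
  have fin: "finite A" "finite B" "finite C"
    using assms by (auto simp: C_def intro: finite_subset)
  define a b c where "a = real (card A)" and "b = real (card B)" and "c = real (card C)"
  have "card A + card B = card (A \<union> B) + card C"
    using fin card_Un_Int by (auto simp: C_def)
  moreover have "card (A \<union> B) \<le> m"
    using card_mono[of "{..<m}" "A \<union> B"] assms by auto
  ultimately have "a + b \<le> m + c"
    unfolding a_def b_def c_def by linarith
  text \<open>Swapping coordinates shows that at least half of the pairs in \<open>C \<times> C\<close> satisfy \<open>j \<le> i\<close>.\<close>
  have "card {(i, j) \<in> C \<times> C. i \<le> j} = card {(i, j) \<in> C \<times> C. j \<le> i}"
    by (rule bij_betw_same_card[of "\<lambda>(i, j). (j, i)"])
      (auto simp: bij_betw_def inj_on_def image_iff)
  moreover have "card (C \<times> C) \<le> card {(i, j) \<in> C \<times> C. i \<le> j} + card {(i, j) \<in> C \<times> C. j \<le> i}"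
    by (rule order.trans[OF card_mono card_Un_le])
      (use fin in \<open>auto intro: finite_subset[of _ "C \<times> C"]\<close>)
  ultimately have le: "card C * card C \<le> 2 * card {(i, j) \<in> C \<times> C. j \<le> i}"
    by (simp add: card_cartesian_product)
  have "c\<^sup>2 \<le> 2 * real (card {(i, j) \<in> C \<times> C. j \<le> i})"
    using of_nat_mono[OF le, where ?'a = real] by (simp add: c_def power2_eq_square)
  moreover have le: "card {(i, j) \<in> A \<times> B. i < j} + card {(i, j) \<in> C \<times> C. j \<le> i} \<le> card (A \<times> B)"
  proof (subst card_Un_disjoint[symmetric])
    show "card ({(i, j) \<in> A \<times> B. i < j} \<union> {(i, j) \<in> C \<times> C. j \<le> i}) \<le> card (A \<times> B)"
      by (rule card_mono) (use fin in \<open>auto simp: C_def\<close>)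
  qed (use fin in \<open>auto simp: C_def intro: finite_subset[of _ "A \<times> B"]\<close>)
  ultimately have "real (card {(i, j) \<in> A \<times> B. i < j}) \<le> a * b - c\<^sup>2 / 2"
    using of_nat_mono[OF le, where ?'a = real] by (simp add: a_def b_def card_cartesian_product)
  also have "a * b - c\<^sup>2 / 2 \<le> (a + b)\<^sup>2 / 4 - c\<^sup>2 / 2"
    using zero_le_power2[of "a - b"] by (simp add: power2_eq_square algebra_simps)
  also have "(a + b)\<^sup>2 / 4 - c\<^sup>2 / 2 \<le> (a + b) * (m / (2 + sqrt 2))"
  proof (cases "a + b \<le> m")
    \<comment> \<open>Here \<open>c \<ge> a + b - m\<close> gives nothing, but
      \<open>(a + b) / 4 \<le> m / 4\<close> suffices because
      \<open>2 + sqrt 2 \<le> 4\<close>.\<close>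
    case True
    have "(a + b) * (a + b) / 4 \<le> (a + b) * (m / 4)"
      using True mult_left_mono[of "a + b" m "a + b"] by (simp add: a_def b_def)
    also have "\<dots> \<le> (a + b) * (m / (2 + sqrt 2))"
      using sqrt2_less_2 by (intro mult_left_mono divide_left_mono) (auto simp: a_def b_def add_pos_nonneg)
    finally have "(a + b) * (a + b) / 4 \<le> (a + b) * (m / (2 + sqrt 2))" .
    then show ?thesis
      using zero_le_power2[of c] unfolding power2_eq_square by linarith
  next
    case False
    \<comment> \<open>The extremal value of \<open>a + b\<close> is
      \<open>sqrt 2 * m = 2 * t\<close>; there the square of \<open>(a + b) / 2 - t\<close>, used
      below, vanishes.\<close>
    define t where "t = m / sqrt 2"
    have t: "m / (2 + sqrt 2) = m - t" "t\<^sup>2 = (real m)\<^sup>2 / 2"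
      using add_pos_pos[of 2 "sqrt 2"] by (simp_all add: t_def power_divide field_simps)
    have "(a + b - m)\<^sup>2 \<le> c\<^sup>2"
      using False \<open>a + b \<le> m + c\<close> by (intro power_mono) auto
    then have "(a + b)\<^sup>2 + (real m)\<^sup>2 - 2 * ((a + b) * m) \<le> c\<^sup>2"
      by (simp add: power2_eq_square algebra_simps)
    moreover have "(a + b) * t \<le> (a + b)\<^sup>2 / 4 + t\<^sup>2"
      using zero_le_power2[of "(a + b) / 2 - t"] by (simp add: power2_eq_square algebra_simps)
    ultimately show ?thesis
      using t(2) unfolding t(1) right_diff_distrib by linarith
  qed
  finally show ?thesis
    by (simp add: a_def b_def)
qed

text \<open>The last \<open>k\<close> of \<open>m\<close> columns have the indices
  \<open>j + (m - k)\<close>, so the set consists of the prescribed zeros in the first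
  \<open>k\<close> rows and last \<open>k\<close> columns. After a shift of the rows by
  \<open>m - k\<close>, the missing cells form a triangle of side \<open>2 * k - m\<close> including
  its diagonal.\<close>

lemma card_corner_ge:
  assumes "k \<le> m" "m \<le> 2 * k"
  shows "real k ^ 2 - (2 * real k - real m) * (2 * real k - real m + 1) / 2
    \<le> card {(i, j) \<in> {..<k} \<times> {..<k}. i < j + (m - k)}"
proof -
  define c where "c = 2 * k - m"
  have "card (SIGMA i:{..<c}. {..i}) = (\<Sum>i<c. Suc i)"
    by simp
  also have "2 * (\<Sum>i<c. Suc i) = c * Suc c"
    by (induction c) auto
  finally have card_D: "2 * card (SIGMA i:{..<c}. {..i}) = c * Suc c"
    by simp
  have "{..<k} \<times> {..<k} \<subseteq> {(i, j) \<in> {..<k} \<times> {..<k}. i < j + (m - k)} \<union>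
      (\<lambda>(i, j). (i + (m - k), j)) ` (SIGMA i:{..<c}. {..i})" (is "_ \<subseteq> ?N \<union> _ ` ?D")
  proof
    fix x
    assume x: "x \<in> {..<k} \<times> {..<k}"
    then obtain i j where ij: "x = (i, j)" "i < k" "j < k"
      by auto
    show "x \<in> ?N \<union> (\<lambda>(i, j). (i + (m - k), j)) ` ?D"
    proof (cases "i < j + (m - k)")
      case False
      then have "x = (\<lambda>(i, j). (i + (m - k), j)) (i - (m - k), j)" "(i - (m - k), j) \<in> ?D"
        using ij assms unfolding c_def by auto
      then show ?thesis
        by blast
    qed (use ij in auto)
  qed
  then have "card ({..<k} \<times> {..<k}) \<le> card (?N \<union> (\<lambda>(i, j). (i + (m - k), j)) ` ?D)"
    by (rule card_mono[rotated]) (auto intro: finite_subset[of _ "{..<k} \<times> {..<k}"])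
  also have "\<dots> \<le> card ?N + card ?D"
    by (rule order.trans[OF card_Un_le add_left_mono[OF card_image_le]]) auto
  finally have le: "2 * (k * k) \<le> 2 * card ?N + c * Suc c"
    using card_D by (simp add: card_cartesian_product)
  have "2 * (real k * real k) \<le> 2 * real (card ?N) + real c * (real c + 1)"
    using of_nat_mono[OF le, where ?'a = real] by (simp add: algebra_simps)
  moreover have "real c = 2 * real k - real m"
    using assms by (simp add: c_def of_nat_diff)
  ultimately show ?thesis
    by (simp add: power2_eq_square field_simps)
qed

section \<open>Moment bounds\<close>

text \<open>Chebyshev's inequality for the number \<open>f\<close> of events that occur: if none
  occurs, \<open>f\<close> deviates from its mean by the whole mean.\<close>

lemma (in prob_space) prob_none_le_second_moment:
  assumes "finite I" and E: "\<And>i. i \<in> I \<Longrightarrow> E i \<in> events"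
    and pos: "0 < (\<Sum>i\<in>I. prob (E i))"
  shows "prob {\<omega> \<in> space M. \<forall>i\<in>I. \<omega> \<notin> E i}
    \<le> (\<Sum>i\<in>I. \<Sum>j\<in>I. prob (E i \<inter> E j)) / (\<Sum>i\<in>I. prob (E i))\<^sup>2 - 1"
proof -
  define f :: "'a \<Rightarrow> real" where "f \<omega> = (\<Sum>i\<in>I. indicator (E i) \<omega>)" for \<omega>
  define \<mu> where "\<mu> = (\<Sum>i\<in>I. prob (E i))"
  have int: "integrable M (indicator (E i) :: 'a \<Rightarrow> real)" if "i \<in> I" for i
    using E[OF that] by (intro integrable_real_indicator) (auto simp: less_top[symmetric])
  have int2: "integrable M (indicator (E i \<inter> E j) :: 'a \<Rightarrow> real)" if "i \<in> I" "j \<in> I" for i j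
    using E that by (intro integrable_real_indicator) (auto simp: less_top[symmetric])
  have f_sq: "(f \<omega>)\<^sup>2 = (\<Sum>i\<in>I. \<Sum>j\<in>I. (indicator (E i \<inter> E j) \<omega> :: real))" for \<omega>
    by (simp add: f_def power2_eq_square sum_product indicator_inter_arith)
  have int_f: "integrable M f"
    unfolding f_def using int by (intro Bochner_Integration.integrable_sum)
  have int_f_sq: "integrable M (\<lambda>\<omega>. (f \<omega>)\<^sup>2)"
    unfolding f_sq using int2 by (intro Bochner_Integration.integrable_sum)
  have exp_f: "expectation f = \<mu>"
    unfolding f_def \<mu>_def using E int by (subst Bochner_Integration.integral_sum) auto
  have "expectation (\<lambda>\<omega>. (f \<omega>)\<^sup>2) = (\<Sum>i\<in>I. expectation (\<lambda>\<omega>. \<Sum>j\<in>I. (indicator (E i \<inter> E j) \<omega> :: real)))"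
    unfolding f_sq using int2
    by (intro Bochner_Integration.integral_sum Bochner_Integration.integrable_sum)
  also have "\<dots> = (\<Sum>i\<in>I. \<Sum>j\<in>I. prob (E i \<inter> E j))"
  proof (rule sum.cong[OF refl])
    fix i
    assume "i \<in> I"
    then have "expectation (\<lambda>\<omega>. \<Sum>j\<in>I. (indicator (E i \<inter> E j) \<omega> :: real)) =
        (\<Sum>j\<in>I. expectation (indicator (E i \<inter> E j) :: 'a \<Rightarrow> real))"
      using int2 by (intro Bochner_Integration.integral_sum)
    also have "\<dots> = (\<Sum>j\<in>I. prob (E i \<inter> E j))"
      using E \<open>i \<in> I\<close> by (intro sum.cong) auto
    finally show "expectation (\<lambda>\<omega>. \<Sum>j\<in>I. (indicator (E i \<inter> E j) \<omega> :: real)) = (\<Sum>j\<in>I. prob (E i \<inter> E j))" .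
  qed
  finally have var: "variance f = (\<Sum>i\<in>I. \<Sum>j\<in>I. prob (E i \<inter> E j)) - \<mu>\<^sup>2"
    using variance_eq[OF int_f int_f_sq] exp_f by simp
  have "prob {\<omega> \<in> space M. \<forall>i\<in>I. \<omega> \<notin> E i} \<le> prob {\<omega> \<in> space M. \<mu> \<le> \<bar>f \<omega> - \<mu>\<bar>}"
  proof (rule finite_measure_mono)
    show "{\<omega> \<in> space M. \<mu> \<le> \<bar>f \<omega> - \<mu>\<bar>} \<in> events"
      using borel_measurable_integrable[OF int_f] by measurable
    show "{\<omega> \<in> space M. \<forall>i\<in>I. \<omega> \<notin> E i} \<subseteq> {\<omega> \<in> space M. \<mu> \<le> \<bar>f \<omega> - \<mu>\<bar>}"
      by (auto simp: f_def)
  qed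
  also have "\<dots> \<le> variance f / \<mu>\<^sup>2"
    using Chebyshev_inequality[OF borel_measurable_integrable[OF int_f] int_f_sq, of \<mu>] pos
    unfolding exp_f \<mu>_def by simp
  also have "\<dots> = (\<Sum>i\<in>I. \<Sum>j\<in>I. prob (E i \<inter> E j)) / \<mu>\<^sup>2 - 1"
    using pos unfolding var by (simp add: diff_divide_distrib \<mu>_def)
  finally show ?thesis
    unfolding \<mu>_def .
qed

section \<open>Random matrices: probabilities of prescribed entries, measurability, and the first
  moment bound\<close>

locale iid_matrix = prob_space M for M :: "'w measure" +
  fixes n :: nat and A :: "'a::zero_neq_one set" and p :: "'a pmf" and X :: "'w \<Rightarrow> 'a mat"
  assumes iid: "iid_random_matrix M n A p X"
    and zero_in: "0 \<in> A" and one_in: "1 \<in> A"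
    and pmf0_pos: "0 < pmf p 0" and pmf1_pos: "0 < pmf p 1"
begin

definition cells :: "(nat \<times> nat) set \<Rightarrow> (nat \<times> nat \<Rightarrow> 'a) \<Rightarrow> 'w set"
  where "cells S v = {\<omega> \<in> space M. \<forall>c\<in>S. X \<omega> $$ c = v c}"

lemma dim_X:
  assumes "\<omega> \<in> space M"
  shows "dim_row (X \<omega>) = n" "dim_col (X \<omega>) = n"
  using iid assms by (auto simp: iid_random_matrix_def)

text \<open>Independence provides measurability into \<open>count_space A\<close>, where
  \<open>{a}\<close> is a measurable set because \<open>a \<in> A\<close>.\<close>

lemma entry_event:
  assumes "c \<in> {..<n} \<times> {..<n}" "a \<in> A"
  shows "{\<omega> \<in> space M. X \<omega> $$ c = a} \<in> events"
proof -
  have "(\<lambda>\<omega>. X \<omega> $$ c) \<in> measurable M (count_space A)"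
    using iid assms(1) unfolding iid_random_matrix_def indep_vars_def2 by blast
  from measurable_sets[OF this, of "{a}"] show ?thesis
    using assms(2) by (simp add: vimage_def Int_def conj_commute)
qed

lemma cells_event:
  assumes "S \<subseteq> {..<n} \<times> {..<n}" "v ` S \<subseteq> A"
  shows "cells S v \<in> events"
  unfolding cells_def
proof (rule sets.sets_Collect_finite_All)
  show "finite S"
    using assms(1) finite_subset by blast
qed (use assms in \<open>auto intro!: entry_event\<close>)

lemma prob_cells:
  assumes "S \<subseteq> {..<n} \<times> {..<n}" "v ` S \<subseteq> A"
  shows "prob (cells S v) = (\<Prod>c\<in>S. pmf p (v c))"
proof (cases "S = {}")
  \<comment> \<open>The empty pattern is separate because an intersection over no cells would be the
    whole type instead of \<open>space M\<close>.\<close>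
  case True
  then show ?thesis
    by (simp add: cells_def prob_space)
next
  case False
  have "finite S"
    using assms(1) finite_subset by blast
  have vimage: "(\<lambda>\<omega>. X \<omega> $$ c) -` {v c} \<inter> space M = {\<omega> \<in> space M. X \<omega> $$ c = v c}" for c
    by auto
  have "cells S v = (\<Inter>c\<in>S. (\<lambda>\<omega>. X \<omega> $$ c) -` {v c} \<inter> space M)"
    using False by (auto simp: cells_def)
  also have "prob \<dots> = (\<Prod>c\<in>S. prob ((\<lambda>\<omega>. X \<omega> $$ c) -` {v c} \<inter> space M))"
    using iid assms False \<open>finite S\<close> unfolding iid_random_matrix_def
    by (intro indep_varsD[where M' = "\<lambda>_. count_space A" and I = "{..<n} \<times> {..<n}"]) auto
  also have "\<dots> = (\<Prod>c\<in>S. pmf p (v c))"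
  proof (rule prod.cong[OF refl])
    fix c
    assume "c \<in> S"
    then have "fst c < n" "snd c < n" "v c \<in> A"
      using assms by auto
    moreover have "measure M {\<omega> \<in> space M. X \<omega> $$ (i, j) = a} = pmf p a"
      if "i < n" "j < n" "a \<in> A" for i j a
      using iid that unfolding iid_random_matrix_def by blast
    ultimately show "prob ((\<lambda>\<omega>. X \<omega> $$ c) -` {v c} \<inter> space M) = pmf p (v c)"
      unfolding vimage by (metis prod.collapse)
  qed
  finally show ?thesis .
qed

text \<open>The conditions on the lists alone do not depend on \<omega>, since the dimensions of
  \<open>X \<omega>\<close> are constant on \<open>space M\<close>; what remains is a finite
  combination of conditions on entries.\<close>

lemma tri_index_event: "{\<omega> \<in> space M. tri_index ordered special (X \<omega>) rs cs} \<in> events"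
proof (cases "ordered rs \<and> ordered cs \<and> length cs = length rs \<and> set rs \<subseteq> {..<n} \<and> set cs \<subseteq> {..<n}")
  case True
  then have rs: "rs ! i < n" "cs ! i < n" if "i < length rs" for i
    using that nth_mem by (auto simp: subset_iff)
  have "{\<omega> \<in> space M. tri_index ordered special (X \<omega>) rs cs} =
      {\<omega> \<in> space M. (\<forall>i\<in>{..<length rs}. \<forall>j\<in>{..<length rs}. i < j \<longrightarrow> X \<omega> $$ (rs ! i, cs ! j) = 0) \<and>
        (special \<longrightarrow> (\<forall>i\<in>{..<length rs}. X \<omega> $$ (rs ! i, cs ! i) = 1))}"
    using True by (auto simp: tri_index_def dim_X)
  also have "\<dots> \<in> events"
    using rs zero_in one_in
    by (intro sets.sets_Collect_conj sets.sets_Collect_finite_All sets.sets_Collect_imp entry_event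
          sets.sets_Collect_const) auto
  finally show ?thesis .
next
  case False
  then have "{\<omega> \<in> space M. tri_index ordered special (X \<omega>) rs cs} = {}"
    by (auto simp: tri_index_def dim_X)
  then show ?thesis
    by (simp only: sets.empty_sets)
qed

text \<open>By \<open>le_T_iff\<close> the event is a union over pairs of lists of naturals, of
  which there are countably many.\<close>

lemma le_T_event:
  assumes "T \<in> {T_tri, T_special, T_perm, T_perm_special}"
  shows "{\<omega> \<in> space M. t \<le> T (X \<omega>)} \<in> events"
proof (cases "t = 0")
  case False
  have "{\<omega> \<in> space M. \<exists>rs cs. tri_index ordered special (X \<omega>) rs cs \<and> t \<le> length rs} \<in> events"
    for ordered special
    by (intro sets.sets_Collect_countable_Ex sets.sets_Collect_conj tri_index_event
          sets.sets_Collect_const)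
  then show ?thesis
    using assms False by (auto simp: le_T_iff)
qed auto

lemma T_measurable:
  assumes "T \<in> {T_tri, T_special, T_perm, T_perm_special}"
  shows "(\<lambda>\<omega>. real (T (X \<omega>))) \<in> borel_measurable M"
  unfolding borel_measurable_iff_ge
proof
  fix a :: real
  have eq: "{\<omega> \<in> space M. a \<le> real (T (X \<omega>))} = {\<omega> \<in> space M. nat \<lceil>a\<rceil> \<le> T (X \<omega>)}"
    by (auto simp: ceiling_le_iff nat_le_iff)
  show "{\<omega> \<in> space M. a \<le> real (T (X \<omega>))} \<in> events"
    unfolding eq by (rule le_T_event[OF assms])
qed

text \<open>Union bound over the choices of the first \<open>k\<close> rows and the last
  \<open>k\<close> columns: there are at most \<open>n ^ k\<close> lists of each kind, and
  distinctness of the lists makes the prescribed zeros lie in different cells.\<close>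

lemma prob_T_perm_ge_le:
  assumes "k \<le> m" "0 < m"
  shows "prob {\<omega> \<in> space M. m \<le> T_perm (X \<omega>)} \<le>
    real n ^ (2 * k) * pmf p 0 ^ card {(i, j) \<in> {..<k} \<times> {..<k}. i < j + (m - k)}"
proof -
  define N where "N = {(i, j) \<in> {..<k} \<times> {..<k}. i < j + (m - k)}"
  define L where "L = {xs. set xs \<subseteq> {..<n} \<and> length xs = k \<and> distinct xs}"
  define S where "S = (\<lambda>(rs :: nat list, cs :: nat list). (\<lambda>(i, j). (rs ! i, cs ! j)) ` N)"
  have "L \<subseteq> {xs. set xs \<subseteq> {..<n} \<and> length xs = k}"
    by (auto simp: L_def)
  then have "finite L" and card_L: "card L \<le> n ^ k"
    using finite_lists_length_eq[of "{..<n}" k] card_lists_length_eq[of "{..<n}" k]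
      card_mono[of "{xs. set xs \<subseteq> {..<n} \<and> length xs = k}" L]
    by (auto intro: finite_subset)
  have S: "S x \<subseteq> {..<n} \<times> {..<n}" if "x \<in> L \<times> L" for x
  proof -
    have "xs ! i < n" if "xs \<in> L" "i < k" for xs i
      using that subsetD[OF _ nth_mem, of xs "{..<n}" i] by (simp add: L_def)
    then show ?thesis
      using that by (auto simp: S_def N_def)
  qed
  have prob_S: "prob (cells (S x) (\<lambda>_. 0)) = pmf p 0 ^ card N" if x_in: "x \<in> L \<times> L" for x
  proof -
    obtain rs cs where x: "x = (rs, cs)" "distinct rs" "distinct cs" "length rs = k" "length cs = k"
      using x_in by (auto simp: L_def)
    then have "inj_on (\<lambda>(i, j). (rs ! i, cs ! j)) N"
      by (auto simp: inj_on_def N_def nth_eq_iff_index_eq)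
    then have "card (S x) = card N"
      unfolding S_def x by (simp add: card_image)
    then show ?thesis
      using prob_cells[OF S[OF x_in], of "\<lambda>_. 0"] zero_in by (simp add: image_subset_iff)
  qed
  have "{\<omega> \<in> space M. m \<le> T_perm (X \<omega>)} \<subseteq> (\<Union>x\<in>L \<times> L. cells (S x) (\<lambda>_. 0))"
  proof clarify
    fix \<omega>
    assume \<omega>: "\<omega> \<in> space M" and "m \<le> T_perm (X \<omega>)"
    then obtain rs cs where rs: "tri_index distinct False (X \<omega>) rs cs" "m \<le> length rs"
      using le_T_perm_iff[OF \<open>0 < m\<close>] by blast
    \<comment> \<open>The lists may be longer than \<open>m\<close>. Only the leading part of size
      \<open>m\<close> is used: its rows \<open>0, ..., k - 1\<close> and its columns
      \<open>m - k, ..., m - 1\<close>.\<close>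
    define rs' cs' where "rs' = take k rs" and "cs' = take k (drop (m - k) cs)"
    have "set rs' \<subseteq> set rs" "set cs' \<subseteq> set cs"
      unfolding rs'_def cs'_def by (meson set_take_subset set_drop_subset subset_trans)+
    then have "(rs', cs') \<in> L \<times> L"
      using rs assms(1) \<omega> by (auto simp: L_def tri_index_def rs'_def cs'_def dim_X)
    moreover have "X \<omega> $$ c = 0" if c: "c \<in> S (rs', cs')" for c
    proof -
      obtain i j where "c = (rs' ! i, cs' ! j)" and ij: "i < k" "j < k" "i < j + (m - k)"
        using c by (auto simp: S_def N_def)
      then have "c = (rs ! i, cs ! (j + (m - k)))"
        using rs assms(1) by (simp add: rs'_def cs'_def tri_index_def add.commute)
      then show ?thesis
        using rs ij assms(1) unfolding tri_index_def by auto
    qed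
    ultimately show "\<omega> \<in> (\<Union>x\<in>L \<times> L. cells (S x) (\<lambda>_. 0))"
      using \<omega> unfolding cells_def by blast
  qed
  moreover have events: "cells (S x) (\<lambda>_. 0) \<in> events" if "x \<in> L \<times> L" for x
    using S[OF that] zero_in by (intro cells_event) auto
  ultimately have "prob {\<omega> \<in> space M. m \<le> T_perm (X \<omega>)} \<le> prob (\<Union>x\<in>L \<times> L. cells (S x) (\<lambda>_. 0))"
    using \<open>finite L\<close> by (intro finite_measure_mono) auto
  also have "\<dots> \<le> (\<Sum>x\<in>L \<times> L. prob (cells (S x) (\<lambda>_. 0)))"
    using \<open>finite L\<close> events by (intro finite_measure_subadditive_finite) auto
  also have "\<dots> = real (card L * card L) * pmf p 0 ^ card N"
    by (simp add: prob_S card_cartesian_product)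
  also have "\<dots> \<le> real n ^ (2 * k) * pmf p 0 ^ card N"
    using of_nat_mono[OF mult_mono[OF card_L card_L], where ?'a = real]
    by (intro mult_right_mono) (auto simp: power_add mult_2)
  finally show ?thesis
    by (simp only: N_def)
qed

end

section \<open>Second moment of the block choices\<close>

lemma sum_power_card_agree:
  fixes x :: "'a::comm_ring_1"
  assumes f: "f \<in> {..<m} \<rightarrow> {..<K}"
  shows "(\<Sum>g\<in>{..<m} \<rightarrow>\<^sub>E {..<K}. x ^ card {i \<in> {..<m}. f i = g i}) = (of_nat K - 1 + x) ^ m"
proof -
  \<comment> \<open>Exactly one of the \<open>K\<close> values agrees with \<open>f i\<close>. The
    weight of \<open>g\<close> is a product over coordinates, so the full sum is the product of
    these sums.\<close>
  have "(\<Sum>y<K. if f i = y then x else 1) = of_nat K - 1 + x" if "i < m" for i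
  proof -
    have "f i \<in> {..<K}"
      using f that by auto
    then have "(\<Sum>y<K. if f i = y then x else 1) = x + (\<Sum>y\<in>{..<K} - {f i}. 1)"
      by (subst sum.remove[of _ "f i"]) auto
    then show ?thesis
      using \<open>f i \<in> {..<K}\<close> by (simp add: of_nat_diff)
  qed
  then have "(of_nat K - 1 + x) ^ m = (\<Prod>i<m. \<Sum>y<K. if f i = y then x else 1)"
    by simp
  also have "\<dots> = (\<Sum>g\<in>{..<m} \<rightarrow>\<^sub>E {..<K}. \<Prod>i<m. if f i = g i then x else 1)"
    by (rule prod_sum_PiE) auto
  also have "\<dots> = (\<Sum>g\<in>{..<m} \<rightarrow>\<^sub>E {..<K}. x ^ card {i \<in> {..<m}. f i = g i})"
    by (simp add: prod.If_cases Int_def)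
  finally show ?thesis ..
qed

context iid_matrix
begin

text \<open>The product is the probability of the prescriptions shared by two block choices that
  agree on the rows \<open>A'\<close> and the columns \<open>B'\<close>. Its reciprocal is at most
  one factor \<theta> per shared row or column: \<open>card_less_pairs_le\<close> accounts for the
  zeros, and the division by \<open>pmf p 1\<close> for the ones. Having separate powers for rows
  and columns lets the later sum factorise.\<close>

lemma prod_block_weights_ge:
  fixes A' B' :: "nat set" and m :: nat
  assumes "A' \<subseteq> {..<m}" "B' \<subseteq> {..<m}"
  defines "\<theta> \<equiv> (1 / pmf p 0) powr (m / (2 + sqrt 2)) / pmf p 1"
  shows "1 \<le> \<theta> ^ card A' * \<theta> ^ card B' *
    (\<Prod>(i, j)\<in>{(i, j) \<in> A' \<times> B'. i \<le> j}. pmf p (if i = j then 1 else 0))"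
proof -
  define Z where "Z = {(i, j) \<in> A' \<times> B'. i < j}"
  define D where "D = (\<lambda>i. (i, i)) ` (A' \<inter> B')"
  have fin: "finite A'" "finite B'"
    using finite_subset[OF assms(1)] finite_subset[OF assms(2)] by simp_all
  have "finite Z" "finite D"
    using fin by (auto simp: Z_def D_def intro: finite_subset[of _ "A' \<times> B'"])
  have "{(i, j) \<in> A' \<times> B'. i \<le> j} = Z \<union> D" "Z \<inter> D = {}"
    by (auto simp: Z_def D_def)
  then have "(\<Prod>(i, j)\<in>{(i, j) \<in> A' \<times> B'. i \<le> j}. pmf p (if i = j then 1 else 0)) =
      (\<Prod>(i, j)\<in>Z. pmf p (if i = j then 1 else 0)) * (\<Prod>(i, j)\<in>D. pmf p (if i = j then 1 else 0))"
    using \<open>finite Z\<close> \<open>finite D\<close> by (simp add: prod.union_disjoint)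
  also have "(\<Prod>(i, j)\<in>Z. pmf p (if i = j then 1 else 0)) = (\<Prod>x\<in>Z. pmf p 0)"
    by (rule prod.cong) (auto simp: Z_def)
  also have "(\<Prod>(i, j)\<in>D. pmf p (if i = j then 1 else 0)) = pmf p 1 ^ card (A' \<inter> B')"
    unfolding D_def by (subst prod.reindex) (auto simp: inj_on_def)
  finally have eq: "(\<Prod>(i, j)\<in>{(i, j) \<in> A' \<times> B'. i \<le> j}. pmf p (if i = j then 1 else 0)) =
      pmf p 0 ^ card Z * pmf p 1 ^ card (A' \<inter> B')"
    by simp
  \<comment> \<open>A crude estimate for the diagonal is enough, as it only costs the constant
    factor \<open>1 / pmf p 1\<close> in \<theta>.\<close>
  have "card (A' \<inter> B') \<le> card A' + card B'"
    using card_mono[OF fin(1), of "A' \<inter> B'"] by simp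
  then have one: "pmf p 1 ^ (card A' + card B') \<le> pmf p 1 ^ card (A' \<inter> B')"
    by (intro power_decreasing) (auto simp: pmf_le_1)
  have "(1 / pmf p 0) powr card Z \<le> (1 / pmf p 0) powr ((card A' + card B') * (m / (2 + sqrt 2)))"
    using card_less_pairs_le[OF assms(1,2)] pmf0_pos pmf_le_1[of p 0]
    unfolding Z_def by (intro powr_mono) (auto simp: divide_simps)
  also have "\<dots> = ((1 / pmf p 0) powr (m / (2 + sqrt 2))) ^ (card A' + card B')"
    using pmf0_pos by (simp add: powr_realpow[symmetric] powr_powr mult.commute)
  finally have zero: "1 \<le> ((1 / pmf p 0) powr (m / (2 + sqrt 2))) ^ (card A' + card B') * pmf p 0 ^ card Z"
    using pmf0_pos by (simp add: powr_realpow power_one_over divide_simps)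
  have "1 \<le> ((1 / pmf p 0) powr (m / (2 + sqrt 2))) ^ (card A' + card B') * pmf p 0 ^ card Z *
      (pmf p 1 ^ card (A' \<inter> B') / pmf p 1 ^ (card A' + card B'))"
    using one pmf1_pos by (intro mult_ge1_I[OF zero]) (simp add: le_divide_eq)
  also have "\<dots> = \<theta> ^ card A' * \<theta> ^ card B' * (pmf p 0 ^ card Z * pmf p 1 ^ card (A' \<inter> B'))"
    by (simp add: \<theta>_def power_add power_divide)
  finally show ?thesis
    unfolding eq .
qed

text \<open>Second moment bound for the events \<open>E (f, g)\<close> that the block choice given
  by \<open>f\<close> and \<open>g\<close> is special triangular. They all have probability \<pi>,
  and the excess from overlaps is controlled by the numbers of coordinates on which two choices
  agree.\<close>

lemma prob_T_special_less_le:
  fixes m K :: nat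
  assumes "0 < m" "0 < K" "m * K \<le> n"
  defines "\<theta> \<equiv> (1 / pmf p 0) powr (m / (2 + sqrt 2)) / pmf p 1"
  shows "prob {\<omega> \<in> space M. T_special (X \<omega>) < m} \<le> (1 + \<theta> / K) ^ (2 * m) - 1"
proof -
  define P where "P = {(i, j). i \<le> j \<and> j < m}"
  \<comment> \<open>The elements of \<open>F\<close> are offsets within the \<open>m\<close> blocks;
    extensional functions give exactly \<open>K ^ m\<close> of them.\<close>
  define F where "F = {..<m} \<rightarrow>\<^sub>E {..<K}"
  define \<phi> where "\<phi> = (\<lambda>(f :: nat \<Rightarrow> nat, g :: nat \<Rightarrow> nat) (i, j). (i * K + f i, j * K + g j))"
  \<comment> \<open>As row \<open>i\<close> comes from block \<open>i\<close>, the value prescribed for a cell does not depend on \<open>(f, g)\<close>.\<close>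
  define v :: "nat \<times> nat \<Rightarrow> 'a" where "v = (\<lambda>(x, y). if x div K = y div K then 1 else 0)"
  define E where "E fg = cells (\<phi> fg ` P) v" for fg
  define \<pi> where "\<pi> = (\<Prod>(i, j)\<in>P. pmf p (if i = j then 1 else 0))"
  have "finite F"
    unfolding F_def by (intro finite_PiE) auto
  have "finite P"
    by (rule finite_subset[of _ "{..<m} \<times> {..<m}"]) (auto simp: P_def)
  have F_less: "f i < K" if "f \<in> F" "i < m" for f i
    using that by (auto simp: F_def)
  have block: "i * K + f i < n" if "f \<in> F" "i < m" for f i
  proof -
    have "i * K + f i < Suc i * K"
      using F_less[OF that] by simp
    also have "\<dots> \<le> m * K"
      using that by (intro mult_right_mono) auto
    finally show ?thesis
      using assms(3) by simp
  qed
  have block_eq_iff: "i * K + f i = i' * K + f' i' \<longleftrightarrow> i = i' \<and> f i = f' i'"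
    if "f \<in> F" "f' \<in> F" "i < m" "i' < m" for f f' i i'
  proof
    assume eq: "i * K + f i = i' * K + f' i'"
    have "i = (i * K + f i) div K" "i' = (i' * K + f' i') div K"
      using F_less that \<open>0 < K\<close> by simp_all
    then show "i = i' \<and> f i = f' i'"
      using eq by auto
  qed auto
  have sub: "\<phi> fg ` P \<subseteq> {..<n} \<times> {..<n}" if "fg \<in> F \<times> F" for fg
    using that block by (auto simp: \<phi>_def P_def)
  have v_in: "v ` S \<subseteq> A" for S
    using zero_in one_in by (auto simp: v_def)
  have v_\<phi>: "v (\<phi> fg (i, j)) = (if i = j then 1 else 0)" if "fg \<in> F \<times> F" "i \<le> j" "j < m" for fg i j
    using that F_less \<open>0 < K\<close> by (auto simp: v_def \<phi>_def)
  have inj: "inj_on (\<phi> fg) P" if "fg \<in> F \<times> F" for fg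
    using that block_eq_iff by (auto simp: inj_on_def \<phi>_def P_def)
  have prod_\<phi>: "(\<Prod>c\<in>\<phi> fg ` P'. pmf p (v c)) = (\<Prod>(i, j)\<in>P'. pmf p (if i = j then 1 else 0))"
    if "fg \<in> F \<times> F" "P' \<subseteq> P" for fg P'
    using that v_\<phi> inj_on_subset[OF inj] by (subst prod.reindex) (auto intro!: prod.cong simp: P_def)
  have prob_E: "prob (E fg) = \<pi>" if "fg \<in> F \<times> F" for fg
    using prob_cells[OF sub[OF that] v_in] prod_\<phi>[OF that] by (simp add: E_def \<pi>_def)
  have E_event: "E fg \<in> events" if "fg \<in> F \<times> F" for fg
    unfolding E_def using sub[OF that] v_in by (intro cells_event)
  have "0 < \<pi>"
    unfolding \<pi>_def using pmf0_pos pmf1_pos by (intro prod_pos) auto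
  have prob_E2: "prob (E (f, g) \<inter> E (f', g')) \<le>
      \<pi>\<^sup>2 * (\<theta> ^ card {i \<in> {..<m}. f i = f' i} * \<theta> ^ card {i \<in> {..<m}. g i = g' i})"
    if "f \<in> F" "g \<in> F" "f' \<in> F" "g' \<in> F" for f g f' g'
  proof -
    define A' where "A' = {i \<in> {..<m}. f i = f' i}"
    define B' where "B' = {i \<in> {..<m}. g i = g' i}"
    define S S' where "S = \<phi> (f, g) ` P" and "S' = \<phi> (f', g') ` P"
    define \<rho> where "\<rho> = (\<Prod>(i, j)\<in>{(i, j) \<in> A' \<times> B'. i \<le> j}. pmf p (if i = j then 1 else 0))"
    have fin: "finite S" "finite S'"
      using \<open>finite P\<close> by (simp_all add: S_def S'_def)
    have "E (f, g) \<inter> E (f', g') = cells (S \<union> S') v"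
      by (auto simp: E_def cells_def S_def S'_def)
    then have "prob (E (f, g) \<inter> E (f', g')) = (\<Prod>c\<in>S \<union> S'. pmf p (v c))"
      using prob_cells[of "S \<union> S'" v] sub[of "(f, g)"] sub[of "(f', g')"] v_in that
      by (simp add: S_def S'_def)
    \<comment> \<open>Both patterns prescribe the same value on a common cell, so multiplying by the
      weights of the common cells separates the two patterns.\<close>
    then have "prob (E (f, g) \<inter> E (f', g')) * (\<Prod>c\<in>S \<inter> S'. pmf p (v c)) =
        (\<Prod>c\<in>S. pmf p (v c)) * (\<Prod>c\<in>S'. pmf p (v c))"
      using prod.union_inter[OF fin] by simp
    also have "\<dots> = \<pi>\<^sup>2"
      using prod_\<phi>[of "(f, g)" P] prod_\<phi>[of "(f', g')" P] that
      by (simp add: S_def S'_def \<pi>_def power2_eq_square)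
    \<comment> \<open>The blocks are disjoint, so a cell determines its block indices, and it is
      common exactly if its row and its column are.\<close>
    also have "S \<inter> S' = \<phi> (f, g) ` {(i, j) \<in> A' \<times> B'. i \<le> j}"
    proof (intro equalityI subsetI)
      fix c
      assume "c \<in> S \<inter> S'"
      then obtain x y where xy: "c = \<phi> (f, g) x" "x \<in> P" "c = \<phi> (f', g') y" "y \<in> P"
        unfolding S_def S'_def by blast
      obtain i j i' j' where ij: "x = (i, j)" "y = (i', j')"
        by (metis prod.exhaust)
      have "i < m" "j < m" "i' < m" "j' < m" "i * K + f i = i' * K + f' i'" "j * K + g j = j' * K + g' j'"
        using xy unfolding ij by (simp_all add: \<phi>_def P_def)
      then have "i = i' \<and> f i = f' i'" "j = j' \<and> g j = g' j'"
        using that block_eq_iff by blast+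
      then show "c \<in> \<phi> (f, g) ` {(i, j) \<in> A' \<times> B'. i \<le> j}"
        using xy unfolding ij by (auto simp: P_def A'_def B'_def)
    next
      fix c
      assume "c \<in> \<phi> (f, g) ` {(i, j) \<in> A' \<times> B'. i \<le> j}"
      then obtain x where x: "x \<in> {(i, j) \<in> A' \<times> B'. i \<le> j}" "c = \<phi> (f, g) x"
        by blast
      then have "x \<in> P" "\<phi> (f, g) x = \<phi> (f', g') x"
        by (auto simp: \<phi>_def P_def A'_def B'_def)
      then show "c \<in> S \<inter> S'"
        using x(2) unfolding S_def S'_def by blast
    qed
    also have "(\<Prod>c\<in>\<phi> (f, g) ` {(i, j) \<in> A' \<times> B'. i \<le> j}. pmf p (v c)) = \<rho>"
      unfolding \<rho>_def using that by (intro prod_\<phi>) (auto simp: P_def B'_def)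
    finally have eq: "prob (E (f, g) \<inter> E (f', g')) * \<rho> = \<pi>\<^sup>2" .
    have "1 \<le> \<theta> ^ card A' * \<theta> ^ card B' * \<rho>"
      unfolding \<theta>_def \<rho>_def by (rule prod_block_weights_ge) (auto simp: A'_def B'_def)
    then have "prob (E (f, g) \<inter> E (f', g')) * 1 \<le>
        prob (E (f, g) \<inter> E (f', g')) * (\<theta> ^ card A' * \<theta> ^ card B' * \<rho>)"
      by (intro mult_left_mono) auto
    also have "\<dots> = (prob (E (f, g) \<inter> E (f', g')) * \<rho>) * (\<theta> ^ card A' * \<theta> ^ card B')"
      by simp
    finally show ?thesis
      unfolding eq by (simp add: A'_def B'_def)
  qed
  have card_F: "card F = K ^ m"
    by (simp add: F_def card_PiE)
  have sum_E: "(\<Sum>fg\<in>F \<times> F. prob (E fg)) = real K ^ (2 * m) * \<pi>"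
    by (simp add: prob_E card_cartesian_product card_F power_add mult_2)
  have "0 < (\<Sum>fg\<in>F \<times> F. prob (E fg))"
    unfolding sum_E using \<open>0 < \<pi>\<close> \<open>0 < K\<close> by simp
  have "0 < \<theta>"
    using pmf0_pos pmf1_pos by (simp add: \<theta>_def)
  have sum_agree: "(\<Sum>f'\<in>F. \<theta> ^ card {i \<in> {..<m}. f i = f' i}) = (real K - 1 + \<theta>) ^ m" if "f \<in> F" for f
    using sum_power_card_agree[of f m K \<theta>] that by (auto simp: F_def)
  have "(\<Sum>x\<in>F \<times> F. \<Sum>y\<in>F \<times> F. prob (E x \<inter> E y)) \<le> (\<Sum>x\<in>F \<times> F. \<pi>\<^sup>2 * (real K - 1 + \<theta>) ^ (2 * m))"
  proof (rule sum_mono, clarify)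
    fix f g
    assume "f \<in> F" "g \<in> F"
    have "(\<Sum>y\<in>F \<times> F. prob (E (f, g) \<inter> E y)) \<le> (\<Sum>y\<in>F \<times> F.
        \<pi>\<^sup>2 * (\<theta> ^ card {i \<in> {..<m}. f i = fst y i} * \<theta> ^ card {i \<in> {..<m}. g i = snd y i}))"
    proof (rule sum_mono)
      fix y
      assume "y \<in> F \<times> F"
      then have "fst y \<in> F" "snd y \<in> F"
        by auto
      from prob_E2[OF \<open>f \<in> F\<close> \<open>g \<in> F\<close> this]
      show "prob (E (f, g) \<inter> E y) \<le> \<pi>\<^sup>2 *
          (\<theta> ^ card {i \<in> {..<m}. f i = fst y i} * \<theta> ^ card {i \<in> {..<m}. g i = snd y i})"
        by simp
    qed
    also have "\<dots> = (\<Sum>f'\<in>F. \<Sum>g'\<in>F.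
        \<pi>\<^sup>2 * (\<theta> ^ card {i \<in> {..<m}. f i = f' i} * \<theta> ^ card {i \<in> {..<m}. g i = g' i}))"
      by (simp only: sum.cartesian_product case_prod_unfold)
    also have "\<dots> = \<pi>\<^sup>2 * ((\<Sum>f'\<in>F. \<theta> ^ card {i \<in> {..<m}. f i = f' i}) *
        (\<Sum>g'\<in>F. \<theta> ^ card {i \<in> {..<m}. g i = g' i}))"
      unfolding sum_product by (simp only: sum_distrib_left)
    also have "\<dots> = \<pi>\<^sup>2 * (real K - 1 + \<theta>) ^ (2 * m)"
      using \<open>f \<in> F\<close> \<open>g \<in> F\<close> by (simp only: sum_agree power_add mult_2)
    finally show "(\<Sum>y\<in>F \<times> F. prob (E (f, g) \<inter> E y)) \<le> \<pi>\<^sup>2 * (real K - 1 + \<theta>) ^ (2 * m)" .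
  qed
  \<comment> \<open>Replacing \<open>K - 1\<close> by \<open>K\<close> is harmless and turns the
    quotient by the squared first moment into a power of \<open>1 + \<theta> / K\<close>.\<close>
  also have "\<dots> \<le> real K ^ (2 * m) * (\<pi>\<^sup>2 * (real K + \<theta>) ^ (2 * m))"
    using \<open>0 < \<theta>\<close> \<open>0 < K\<close>
    by (auto simp: card_cartesian_product card_F power_add mult_2 intro!: mult_left_mono mult_mono power_mono)
  finally have sum_E2: "(\<Sum>x\<in>F \<times> F. \<Sum>y\<in>F \<times> F. prob (E x \<inter> E y)) \<le>
      real K ^ (2 * m) * (\<pi>\<^sup>2 * (real K + \<theta>) ^ (2 * m))" .
  have none: "\<omega> \<notin> E fg" if fg_in: "fg \<in> F \<times> F" and "\<omega> \<in> space M" "T_special (X \<omega>) < m" for \<omega> fg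
  proof
    assume "\<omega> \<in> E fg"
    obtain f g where fg: "fg = (f, g)" "f \<in> F" "g \<in> F"
      using fg_in by auto
    define l where "l h = map (\<lambda>i. i * K + h i) [0..<m]" for h :: "nat \<Rightarrow> nat"
    have sorted: "sorted_wrt (<) (l h)" if "h \<in> F" for h
      unfolding sorted_wrt_iff_nth_less
    proof (intro allI impI)
      fix i j
      assume "i < j" "j < length (l h)"
      then have "i * K + h i < Suc i * K"
        using F_less[OF that, of i] by (simp add: l_def)
      also have "Suc i * K \<le> j * K"
        using \<open>i < j\<close> by (intro mult_le_mono1) simp
      finally show "l h ! i < l h ! j"
        using \<open>i < j\<close> \<open>j < length (l h)\<close> by (simp add: l_def)
    qed
    have cell: "X \<omega> $$ (l f ! i, l g ! j) = (if i = j then 1 else 0)" if "i \<le> j" "j < m" for i j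
    proof -
      have "\<phi> fg (i, j) \<in> \<phi> fg ` P"
        using that by (simp add: P_def)
      then have "X \<omega> $$ \<phi> fg (i, j) = v (\<phi> fg (i, j))"
        using \<open>\<omega> \<in> E fg\<close> unfolding E_def cells_def by blast
      then show ?thesis
        using v_\<phi>[OF \<open>fg \<in> F \<times> F\<close> that] that by (simp add: l_def fg(1) \<phi>_def)
    qed
    have length_l: "length (l h) = m" for h
      by (simp add: l_def)
    have "set (l h) \<subseteq> {..<n}" if "h \<in> F" for h
      using block[OF that] by (auto simp: l_def)
    then have "tri_index (sorted_wrt (<)) True (X \<omega>) (l f) (l g)"
      using sorted fg(2,3) cell \<open>\<omega> \<in> space M\<close> by (simp add: tri_index_def dim_X length_l)
    then have "m \<le> T_special (X \<omega>)"
      unfolding le_T_special_iff[OF \<open>0 < m\<close>]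
      by (intro exI[of _ "l f"] exI[of _ "l g"]) (simp add: length_l)
    then show False
      using that by simp
  qed
  have "{\<omega> \<in> space M. \<forall>fg\<in>F \<times> F. \<omega> \<notin> E fg} = space M - (\<Union>fg\<in>F \<times> F. E fg)"
    by auto
  also have "\<dots> \<in> events"
    using E_event \<open>finite F\<close> by (intro sets.compl_sets sets.finite_UN) auto
  finally have "{\<omega> \<in> space M. \<forall>fg\<in>F \<times> F. \<omega> \<notin> E fg} \<in> events" .
  then have "prob {\<omega> \<in> space M. T_special (X \<omega>) < m} \<le> prob {\<omega> \<in> space M. \<forall>fg\<in>F \<times> F. \<omega> \<notin> E fg}"
    using none by (intro finite_measure_mono) auto
  also have "\<dots> \<le> (\<Sum>x\<in>F \<times> F. \<Sum>y\<in>F \<times> F. prob (E x \<inter> E y)) / (\<Sum>fg\<in>F \<times> F. prob (E fg))\<^sup>2 - 1"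
    using \<open>finite F\<close> E_event \<open>0 < (\<Sum>fg\<in>F \<times> F. prob (E fg))\<close>
    by (intro prob_none_le_second_moment) auto
  also have "\<dots> \<le> real K ^ (2 * m) * (\<pi>\<^sup>2 * (real K + \<theta>) ^ (2 * m)) / (real K ^ (2 * m) * \<pi>)\<^sup>2 - 1"
    unfolding sum_E using sum_E2 by (intro diff_right_mono divide_right_mono) auto
  also have "\<dots> = ((real K + \<theta>) / K) ^ (2 * m) - 1"
    using \<open>0 < \<pi>\<close> \<open>0 < K\<close> by (simp add: power2_eq_square power_divide)
  also have "(real K + \<theta>) / K = 1 + \<theta> / K"
    using \<open>0 < K\<close> by (simp add: add_divide_distrib)
  finally show ?thesis .
qed

end

section \<open>Asymptotics\<close>

text \<open>For \<open>k\<close> near \<open>m / sqrt 2\<close> the corner has at least about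
  \<open>(sqrt 2 - 1) * m\<^sup>2\<close> zeros, while the positions contribute the exponent
  \<open>2 * k * L\<close>, about \<open>sqrt 2 * m * L\<close>. These balance at
  \<open>m = (2 + sqrt 2) * L\<close>, and the excess \<epsilon> makes the total exponent negative
  of order \<open>L\<^sup>2\<close>.\<close>

lemma first_moment_le:
  fixes n m k :: nat and Q \<epsilon> :: real
  defines "L \<equiv> log Q n"
  assumes "1 < Q" "0 < \<epsilon>" "1 \<le> n" and L: "1 \<le> \<epsilon> * (sqrt 2 - 1) * L"
    and m_def: "m = nat \<lceil>(2 + sqrt 2 + \<epsilon>) * L\<rceil>" and k_def: "k = nat \<lceil>m / sqrt 2\<rceil>"
  shows "k \<le> m" "m \<le> 2 * k" "0 < m"
    and "real n ^ (2 * k) * (1 / Q) ^ card {(i, j) \<in> {..<k} \<times> {..<k}. i < j + (m - k)}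
      \<le> Q powr ((2 + sqrt 2 + \<epsilon>) * L * (1 - \<epsilon> * (sqrt 2 - 1) * L) + 2 * L + 2)"
proof -
  define s where "s = sqrt 2"
  define N where "N = card {(i, j) \<in> {..<k} \<times> {..<k}. i < j + (m - k)}"
  define d where "d = real k - m / s"
  have s: "s\<^sup>2 = 2" "1 < s" "s < 2"
    by (auto simp: s_def sqrt2_less_2)
  have "0 \<le> L"
    using assms by (simp add: L_def)
  moreover have "L \<noteq> 0"
    using L by auto
  ultimately have "0 < L"
    by simp
  have k: "m / s \<le> k" "k \<le> m / s + 1"
    using of_int_ceiling_le_add_one[of "m / sqrt 2"] by (simp_all add: k_def s_def of_nat_ceiling)
  then have d: "0 \<le> d" "d \<le> 1"
    by (simp_all add: d_def)
  have m: "(2 + s + \<epsilon>) * L \<le> m"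
    unfolding m_def s_def by (rule of_nat_ceiling)
  moreover have "0 < (2 + s + \<epsilon>) * L"
    using \<open>0 < L\<close> \<open>0 < \<epsilon>\<close> s by simp
  ultimately show "0 < m"
    by simp
  have "m / s \<le> m"
    using s by (simp add: divide_le_eq mult_le_cancel_left1)
  then show "k \<le> m"
    unfolding k_def s_def by (simp add: ceiling_le_iff nat_le_iff)
  have "real m \<le> k * s"
    using k(1) s by (simp add: divide_le_eq)
  also have "\<dots> \<le> real k * 2"
    using s by (intro mult_left_mono) auto
  finally show "m \<le> 2 * k"
    by simp
  have k_eq: "real k = m * s / 2 + d"
  proof -
    have "real m / s = m * s / 2"
      using s by (simp add: field_simps power2_eq_square)
    then show ?thesis
      by (simp add: d_def)
  qed
  \<comment> \<open>The right-hand side is the bound of \<open>card_corner_ge\<close> at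
    \<open>k = m * s / 2 + d\<close>, expanded; only the effects of rounding are estimated.\<close>
  have "(s - 1) * (real m)\<^sup>2 - m - 2 \<le> (s - 1) * (real m)\<^sup>2 + (2 - s) * (m * d) - d\<^sup>2 - (m * ((s - 1) / 2) + d)"
  proof -
    have "0 \<le> (2 - s) * (m * d)"
      using s d by simp
    moreover have "d\<^sup>2 \<le> 1"
      using d by (simp add: power_le_one)
    moreover have "m * ((s - 1) / 2) \<le> real m * 1"
      using s by (intro mult_left_mono) auto
    ultimately show ?thesis
      using d by simp
  qed
  also have "\<dots> = - ((real m)\<^sup>2 / 2 + m * s * d + d\<^sup>2) + 2 * m * (m * s / 2 + d) - (real m)\<^sup>2 / 2
      - (m * s / 2 + d) + real m / 2"
    by (simp add: power2_eq_square field_simps)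
  also have "(real m)\<^sup>2 / 2 + m * s * d + d\<^sup>2 = (real k)\<^sup>2"
    unfolding k_eq power2_sum by (simp add: power_mult_distrib power_divide s(1))
  also have "- (real k)\<^sup>2 + 2 * m * (m * s / 2 + d) - (real m)\<^sup>2 / 2 - (m * s / 2 + d) + real m / 2 =
      (real k)\<^sup>2 - (2 * real k - real m) * (2 * real k - real m + 1) / 2"
    unfolding k_eq[symmetric] by (simp add: power2_eq_square field_simps)
  also have "\<dots> \<le> N"
    unfolding N_def using card_corner_ge[OF \<open>k \<le> m\<close> \<open>m \<le> 2 * k\<close>] by simp
  finally have N: "(s - 1) * (real m)\<^sup>2 - m - 2 \<le> N" .
  have "2 * k * L \<le> (m * s + 2) * L"
    using d k_eq \<open>0 < L\<close> by (intro mult_right_mono) auto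
  \<comment> \<open>The constant \<open>2 + s\<close> enters here through
    \<open>(s - 1) * (2 + s) = s\<close>.\<close>
  moreover have "(s - 1) * ((2 + s + \<epsilon>) * L) \<le> (s - 1) * m"
    using m s by (intro mult_left_mono) auto
  then have "s * L - (s - 1) * m \<le> - (\<epsilon> * (s - 1) * L)"
    using s(1) by (simp add: algebra_simps power2_eq_square)
  then have "m * (s * L - (s - 1) * m + 1) \<le> m * (1 - \<epsilon> * (s - 1) * L)"
    by (intro mult_left_mono) auto
  \<comment> \<open>By the hypothesis on \<open>L\<close> the second factor is not positive, so the
    lower bound for \<open>m\<close> gives an upper bound for the product.\<close>
  moreover have "m * (1 - \<epsilon> * (s - 1) * L) \<le> (2 + s + \<epsilon>) * L * (1 - \<epsilon> * (s - 1) * L)"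
    using L m unfolding s_def by (intro mult_right_mono_neg) auto
  ultimately have exponent: "2 * k * L - N \<le> (2 + s + \<epsilon>) * L * (1 - \<epsilon> * (s - 1) * L) + 2 * L + 2"
    using N by (simp add: algebra_simps power2_eq_square)
  have "real n = Q powr L"
    using assms by (simp add: L_def)
  then have "real n ^ (2 * k) = Q powr (2 * k * L)"
    using \<open>1 < Q\<close> by (simp add: powr_realpow[symmetric] powr_powr mult.commute)
  moreover have "(1 / Q) ^ N = Q powr (- N)"
    using \<open>1 < Q\<close> by (simp add: powr_minus_divide powr_realpow power_one_over)
  ultimately have "real n ^ (2 * k) * (1 / Q) ^ N = Q powr (2 * k * L - N)"
    by (simp add: powr_add[symmetric])
  also have "\<dots> \<le> Q powr ((2 + s + \<epsilon>) * L * (1 - \<epsilon> * (s - 1) * L) + 2 * L + 2)"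
    using exponent \<open>1 < Q\<close> by (intro powr_mono) auto
  finally show "real n ^ (2 * k) * (1 / Q) ^ card {(i, j) \<in> {..<k} \<times> {..<k}. i < j + (m - k)}
      \<le> Q powr ((2 + sqrt 2 + \<epsilon>) * L * (1 - \<epsilon> * (sqrt 2 - 1) * L) + 2 * L + 2)"
    by (simp only: N_def s_def)
qed

text \<open>The quadratic term \<open>- a * b * x\<^sup>2\<close> dominates the exponent.\<close>

lemma first_moment_tendsto:
  fixes a b Q :: real
  assumes "1 < Q" "0 < a" "0 < b"
  shows "((\<lambda>x. Q powr (a * x * (1 - b * x) + 2 * x + 2)) \<longlongrightarrow> 0) at_top"
  using assms by real_asymp

text \<open>The exponential decay beats the square, so the argument of \<open>exp\<close> tends to
  0.\<close>

lemma second_moment_tendsto: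
  fixes a c d Q :: real
  assumes "1 < Q" "0 < d" "0 < c" "0 < a"
  shows "((\<lambda>x. exp (a * (c * x + 1)\<^sup>2 * Q powr (- d * x)) - 1) \<longlongrightarrow> 0) at_top"
  using assms by real_asymp

text \<open>At \<open>x = log Q n\<close> this makes \<open>n\<close> at least \<open>2 * m\<close>
  for block numbers \<open>m \<le> c * x + 1\<close>, so the blocks are nonempty.\<close>

lemma eventually_powr_ge_linear:
  fixes c Q :: real
  assumes "1 < Q" "0 < c"
  shows "eventually (\<lambda>x. 2 * (c * x + 1) \<le> Q powr x) at_top"
  using assms by real_asymp

text \<open>The block length \<open>n div m\<close> is at least \<open>n / (2 * m)\<close>, and
  \<open>Q powr (m / c)\<close> is at most \<open>Q * n * Q powr (- (\<epsilon> / c) * L)\<close>,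
  where the factor \<open>Q\<close> absorbs the 1 added in \<open>m\<close>. The result follows from
  \<open>1 + x \<le> exp x\<close>.\<close>

lemma second_moment_le:
  fixes n m :: nat and Q \<epsilon> r :: real
  defines "L \<equiv> log Q n" and "c \<equiv> 2 + sqrt 2"
  assumes "1 < Q" "0 < r" "0 < \<epsilon>" "\<epsilon> \<le> 1" "1 \<le> n"
    and m_def: "m = nat \<lfloor>(c - \<epsilon>) * L\<rfloor> + 1"
    and large: "2 * (c * L + 1) \<le> Q powr L"
  shows "0 < n div m"
    and "(1 + Q powr (m / c) / r / (n div m)) ^ (2 * m) - 1
      \<le> exp (4 * Q / r * (c * L + 1)\<^sup>2 * Q powr (- (\<epsilon> / c) * L)) - 1"
proof -
  have c: "1 < c"
    by (simp add: c_def add_pos_pos)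
  have "0 \<le> L"
    using assms by (simp add: L_def)
  have n: "real n = Q powr L"
    using assms by (simp add: L_def)
  have "0 \<le> (c - \<epsilon>) * L"
    using \<open>0 \<le> L\<close> c \<open>\<epsilon> \<le> 1\<close> by simp
  then have m: "real m \<le> (c - \<epsilon>) * L + 1"
    unfolding m_def by (simp add: of_nat_floor)
  also have "\<dots> \<le> c * L + 1"
    using \<open>0 \<le> L\<close> \<open>0 < \<epsilon>\<close> by (simp add: mult_right_mono)
  finally have m': "real m \<le> c * L + 1" .
  have "0 < m"
    by (simp add: m_def)
  have "2 * real m \<le> n"
    using m' large n by simp
  then have "2 * m \<le> n"
    by linarith
  then have "2 * m div m \<le> n div m"
    by (rule div_le_mono)
  then show K_pos: "0 < n div m"
    using \<open>0 < m\<close> by simp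
  have "n < m + m * (n div m)"
    using \<open>0 < m\<close> mult_div_mod_eq[of m n] mod_less_divisor[of m n] by linarith
  also have "\<dots> \<le> 2 * m * (n div m)"
    using K_pos mult_le_mono2[of 1 "n div m" m] by simp
  finally have "real n \<le> 2 * m * (n div m)"
    by (metis less_imp_le of_nat_le_iff)
  then have inv_K: "1 / real (n div m) \<le> 2 * m / n"
    using K_pos \<open>1 \<le> n\<close> by (simp add: field_simps)
  have "m / c \<le> ((c - \<epsilon>) * L + 1) / c"
    using m c by (intro divide_right_mono) auto
  also have "\<dots> = (1 - \<epsilon> / c) * L + 1 / c"
    using c by (simp add: field_simps)
  also have "\<dots> \<le> (1 - \<epsilon> / c) * L + 1"
    using c by simp
  finally have "Q powr (m / c) \<le> Q powr ((1 - \<epsilon> / c) * L + 1)"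
    using \<open>1 < Q\<close> by (intro powr_mono) auto
  also have "(1 - \<epsilon> / c) * L + 1 = 1 + (L + - (\<epsilon> / c) * L)"
    by (simp add: algebra_simps)
  also have "Q powr (1 + (L + - (\<epsilon> / c) * L)) = Q * n * Q powr (- (\<epsilon> / c) * L)"
    using \<open>1 < Q\<close> unfolding n powr_add by simp
  finally have Q_powr: "Q powr (m / c) \<le> Q * n * Q powr (- (\<epsilon> / c) * L)" .
  have "2 * m * (Q powr (m / c) / r / (n div m)) = (2 * m / r) * (Q powr (m / c) * (1 / real (n div m)))"
    by simp
  also have "\<dots> \<le> (2 * m / r) * ((Q * n * Q powr (- (\<epsilon> / c) * L)) * (2 * m / n))"
    using inv_K Q_powr \<open>0 < r\<close> \<open>1 < Q\<close> by (intro mult_left_mono mult_mono) auto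
  also have "\<dots> = 4 * Q / r * (real m)\<^sup>2 * Q powr (- (\<epsilon> / c) * L)"
    using \<open>1 \<le> n\<close> by (simp add: power2_eq_square)
  also have "\<dots> \<le> 4 * Q / r * (c * L + 1)\<^sup>2 * Q powr (- (\<epsilon> / c) * L)"
    using m' \<open>0 < r\<close> \<open>1 < Q\<close> by (intro mult_left_mono mult_right_mono power_mono) auto
  finally have le: "2 * m * (Q powr (m / c) / r / (n div m)) \<le>
      4 * Q / r * (c * L + 1)\<^sup>2 * Q powr (- (\<epsilon> / c) * L)" .
  have "(1 + Q powr (m / c) / r / (n div m)) ^ (2 * m) \<le> exp (Q powr (m / c) / r / (n div m)) ^ (2 * m)"
    using \<open>0 < r\<close> by (intro power_mono exp_ge_add_one_self) (auto intro: add_nonneg_nonneg)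
  also have "\<dots> = exp (2 * m * (Q powr (m / c) / r / (n div m)))"
    by (simp add: exp_of_nat_mult[symmetric])
  also have "\<dots> \<le> exp (4 * Q / r * (c * L + 1)\<^sup>2 * Q powr (- (\<epsilon> / c) * L))"
    using le by simp
  finally show "(1 + Q powr (m / c) / r / (n div m)) ^ (2 * m) - 1
      \<le> exp (4 * Q / r * (c * L + 1)\<^sup>2 * Q powr (- (\<epsilon> / c) * L)) - 1"
    by simp
qed

section \<open>Combination of both bounds and passage to the limit\<close>

context iid_matrix
begin

lemma pmf0_less_1: "pmf p 0 < 1"
proof -
  have "pmf p 0 + pmf p 1 = measure (measure_pmf p) {0, 1}"
    by (simp add: measure_measure_pmf_finite)
  also have "\<dots> \<le> 1"
    by simp
  finally show ?thesis
    using pmf1_pos by simp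
qed

text \<open>If \<open>T\<close> is too large, \<open>T_perm\<close> reaches \<open>m\<close>; if it
  is too small, \<open>T_special\<close> stays below \<open>m'\<close>. The lower bound uses its own
  tolerance \<delta>, because \<open>second_moment_le\<close> asks for one of at most 1.\<close>

lemma prob_T_outside_le:
  fixes \<epsilon> \<delta> :: real
  assumes T: "T \<in> {T_tri, T_special, T_perm, T_perm_special}"
    and "1 \<le> n" "0 < \<epsilon>" "0 < \<delta>" "\<delta> \<le> 1" "\<delta> \<le> \<epsilon>"
  defines "Q \<equiv> 1 / pmf p 0" and "c \<equiv> 2 + sqrt 2"
  defines "L \<equiv> log Q n"
  assumes large: "1 \<le> \<epsilon> * (sqrt 2 - 1) * L" "2 * (c * L + 1) \<le> Q powr L"
  shows "prob {\<omega> \<in> space M. \<not> ((c - \<epsilon>) * L < real (T (X \<omega>)) \<and> real (T (X \<omega>)) < (c + \<epsilon>) * L)}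
    \<le> Q powr ((c + \<epsilon>) * L * (1 - \<epsilon> * (sqrt 2 - 1) * L) + 2 * L + 2) +
      (exp (4 * Q / pmf p 1 * (c * L + 1)\<^sup>2 * Q powr (- (\<delta> / c) * L)) - 1)"
    (is "prob ?B \<le> ?u + ?l")
proof -
  define m where "m = nat \<lceil>(c + \<epsilon>) * L\<rceil>"
  define k where "k = nat \<lceil>m / sqrt 2\<rceil>"
  define m' where "m' = nat \<lfloor>(c - \<delta>) * L\<rfloor> + 1"
  have "1 < Q"
    using pmf0_pos pmf0_less_1 by (simp add: Q_def)
  have "0 \<le> L"
    using \<open>1 < Q\<close> \<open>1 \<le> n\<close> by (simp add: L_def)
  note upper = first_moment_le[OF \<open>1 < Q\<close> \<open>0 < \<epsilon>\<close> \<open>1 \<le> n\<close> large(1)[unfolded L_def]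
      m_def[unfolded L_def c_def] k_def, folded c_def L_def]
  note lower = second_moment_le[OF \<open>1 < Q\<close> pmf1_pos \<open>0 < \<delta>\<close> \<open>\<delta> \<le> 1\<close> \<open>1 \<le> n\<close>
      m'_def[unfolded L_def c_def] large(2)[unfolded L_def c_def], folded c_def L_def]
  have "?B \<subseteq> {\<omega> \<in> space M. m \<le> T_perm (X \<omega>)} \<union> {\<omega> \<in> space M. T_special (X \<omega>) < m'}"
  proof clarify
    fix \<omega>
    assume out: "\<not> ((c - \<epsilon>) * L < real (T (X \<omega>)) \<and> real (T (X \<omega>)) < (c + \<epsilon>) * L)"
      and "\<omega> \<in> space M" and not_less: "\<not> T_special (X \<omega>) < m'"
    have "(c - \<epsilon>) * L \<le> (c - \<delta>) * L"
      using \<open>\<delta> \<le> \<epsilon>\<close> \<open>0 \<le> L\<close> by (intro mult_right_mono) auto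
    \<comment> \<open>The 1 added in \<open>m'\<close> makes this strict, as the lower end of the
      interval requires.\<close>
    also have "\<dots> < m'"
      unfolding m'_def by linarith
    also have "m' \<le> T (X \<omega>)"
      using not_less T_special_le[OF T, of "X \<omega>"] by simp
    finally have "(c + \<epsilon>) * L \<le> T (X \<omega>)"
      using out by simp
    then have "m \<le> T (X \<omega>)"
      unfolding m_def by (simp add: ceiling_le_iff nat_le_iff)
    then show "m \<le> T_perm (X \<omega>)"
      using le_T_perm[OF T, of "X \<omega>"] by simp
  qed
  moreover have perm_event: "{\<omega> \<in> space M. m \<le> T_perm (X \<omega>)} \<in> events"
    by (intro le_T_event) simp
  moreover have special_event: "{\<omega> \<in> space M. T_special (X \<omega>) < m'} \<in> events"
  proof -
    have "{\<omega> \<in> space M. T_special (X \<omega>) < m'} = space M - {\<omega> \<in> space M. m' \<le> T_special (X \<omega>)}"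
      by auto
    also have "\<dots> \<in> events"
      by (intro sets.compl_sets le_T_event) simp
    finally show ?thesis .
  qed
  ultimately have "prob ?B \<le> prob ({\<omega> \<in> space M. m \<le> T_perm (X \<omega>)} \<union> {\<omega> \<in> space M. T_special (X \<omega>) < m'})"
    by (intro finite_measure_mono sets.Un)
  also have "\<dots> \<le> prob {\<omega> \<in> space M. m \<le> T_perm (X \<omega>)} + prob {\<omega> \<in> space M. T_special (X \<omega>) < m'}"
    by (rule measure_Un_le[OF perm_event special_event])
  also have "prob {\<omega> \<in> space M. m \<le> T_perm (X \<omega>)} \<le> ?u"
    using prob_T_perm_ge_le[OF upper(1,3)] upper(4) by (simp add: Q_def)
  also have "prob {\<omega> \<in> space M. T_special (X \<omega>) < m'} \<le> ?l"
  proof (rule order.trans[OF _ lower(2)])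
    have "0 < m'"
      by (simp add: m'_def)
    then show "prob {\<omega> \<in> space M. T_special (X \<omega>) < m'} \<le>
        (1 + Q powr (m' / c) / pmf p 1 / (n div m')) ^ (2 * m') - 1"
      unfolding Q_def c_def by (intro prob_T_special_less_le lower(1) times_div_less_eq_dividend)
  qed
  finally show ?thesis
    by simp
qed

lemma T_between_event:
  assumes "T \<in> {T_tri, T_special, T_perm, T_perm_special}"
  shows "{\<omega> \<in> space M. a < real (T (X \<omega>)) \<and> real (T (X \<omega>)) < b} \<in> events"
  using T_measurable[OF assms] by measurable

end

theorem theorem1p2:
  fixes A :: "'a::zero_neq_one set"
    and p :: "'a pmf"
    and M :: "nat \<Rightarrow> 'w measure"
    and X :: "nat \<Rightarrow> 'w \<Rightarrow> 'a mat"
    and T :: "'a mat \<Rightarrow> nat"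
    and Q :: real
  assumes "0 \<in> A" and "1 \<in> A" and "set_pmf p \<subseteq> A"
    and "pmf p 0 > 0" and "pmf p 1 > 0"
    and "\<And>n. n \<ge> 1 \<Longrightarrow> iid_random_matrix (M n) n A p (X n)"
    and "Q = 1 / pmf p 0"
    and "T \<in> {T_tri, T_special, T_perm, T_perm_special}"
  shows "converges_in_probability M (\<lambda>n \<omega>. real (T (X n \<omega>)) / log Q (real n)) (2 + sqrt 2) \<and>
    (\<forall>\<epsilon>>0. (\<lambda>n. measure (M n) {\<omega> \<in> space (M n).
        (2 + sqrt 2 - \<epsilon>) * log Q (real n) < real (T (X n \<omega>)) \<and>
        real (T (X n \<omega>)) < (2 + sqrt 2 + \<epsilon>) * log Q (real n)}) \<longlonglongrightarrow> 1)"
proof -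
  have matrix: "iid_matrix (M n) n A p (X n)" if "1 \<le> n" for n
    using assms(6)[OF that] assms(1,2,4,5)
    by (simp add: iid_matrix_def iid_matrix_axioms_def iid_random_matrix_def)
  have "1 < Q"
    using iid_matrix.pmf0_less_1[OF matrix[OF order.refl]] assms(4,7) by simp
  define c where "c = 2 + sqrt 2"
  have "0 < c"
    by (simp add: c_def add_pos_pos)
  define good where "good \<epsilon> n = {\<omega> \<in> space (M n). (c - \<epsilon>) * log Q n < T (X n \<omega>) \<and>
      T (X n \<omega>) < (c + \<epsilon>) * log Q n}" for \<epsilon> n
  define bad where "bad \<epsilon> n = {\<omega> \<in> space (M n). \<not> ((c - \<epsilon>) * log Q n < T (X n \<omega>) \<and>
      T (X n \<omega>) < (c + \<epsilon>) * log Q n)}" for \<epsilon> n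
  have good_sets: "good \<epsilon> n \<in> sets (M n)" if "1 \<le> n" for \<epsilon> n
    unfolding good_def using iid_matrix.T_between_event[OF matrix[OF that] assms(8)] .
  have bad_eq: "bad \<epsilon> n = space (M n) - good \<epsilon> n" for \<epsilon> n
    by (auto simp: good_def bad_def)
  have log_top: "filterlim (\<lambda>n. log Q (real n)) at_top sequentially"
    using \<open>1 < Q\<close> by real_asymp
  have bad_tendsto: "(\<lambda>n. measure (M n) (bad \<epsilon> n)) \<longlonglongrightarrow> 0" if "0 < \<epsilon>" for \<epsilon>
  proof (rule tendsto_sandwich[OF _ _ tendsto_const])
    \<comment> \<open>For large \<epsilon> the lower tolerance is cut off at 1; a smaller tolerance
      only strengthens the lower bound.\<close>
    define \<delta> where "\<delta> = min \<epsilon> 1"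
    define u where "u L = Q powr ((c + \<epsilon>) * L * (1 - \<epsilon> * (sqrt 2 - 1) * L) + 2 * L + 2) +
        (exp (4 * Q / pmf p 1 * (c * L + 1)\<^sup>2 * Q powr (- (\<delta> / c) * L)) - 1)" for L
    have "0 < \<epsilon> * (sqrt 2 - 1)"
      using \<open>0 < \<epsilon>\<close> by simp
    have "(u \<longlongrightarrow> 0 + 0) at_top"
      unfolding u_def using \<open>1 < Q\<close> \<open>0 < c\<close> \<open>0 < \<epsilon>\<close> \<open>0 < \<epsilon> * (sqrt 2 - 1)\<close> assms(5)
      by (intro tendsto_add first_moment_tendsto second_moment_tendsto) (auto simp: \<delta>_def)
    then show "(\<lambda>n. u (log Q (real n))) \<longlonglongrightarrow> 0"
      using filterlim_compose[OF _ log_top] by simp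
    have "eventually (\<lambda>L. 1 \<le> \<epsilon> * (sqrt 2 - 1) * L) at_top"
      using eventually_ge_at_top[of "1 / (\<epsilon> * (sqrt 2 - 1))"]
    proof eventually_elim
      case (elim L)
      then show ?case
        using \<open>0 < \<epsilon> * (sqrt 2 - 1)\<close> by (simp add: pos_divide_le_eq mult.commute)
    qed
    then have "eventually (\<lambda>n. 1 \<le> \<epsilon> * (sqrt 2 - 1) * log Q (real n)) sequentially"
      using eventually_compose_filterlim[OF _ log_top] by blast
    moreover have "eventually (\<lambda>n. 2 * (c * log Q (real n) + 1) \<le> Q powr log Q (real n)) sequentially"
      using eventually_compose_filterlim[OF eventually_powr_ge_linear log_top] \<open>1 < Q\<close> \<open>0 < c\<close> by blast
    ultimately show "eventually (\<lambda>n. measure (M n) (bad \<epsilon> n) \<le> u (log Q (real n))) sequentially"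
      using eventually_ge_at_top[of 1]
    proof eventually_elim
      case (elim n)
      then show ?case
        using iid_matrix.prob_T_outside_le[OF matrix assms(8), of n \<epsilon> \<delta>] \<open>0 < \<epsilon>\<close>
        by (simp add: bad_def u_def c_def \<delta>_def assms(7))
    qed
  qed simp
  have "(\<lambda>n. measure (M n) (good \<epsilon> n)) \<longlonglongrightarrow> 1" if "0 < \<epsilon>" for \<epsilon>
  proof (rule Lim_transform_eventually)
    show "(\<lambda>n. 1 - measure (M n) (bad \<epsilon> n)) \<longlonglongrightarrow> 1"
      using tendsto_diff[OF tendsto_const bad_tendsto[OF that], of 1] by simp
    \<comment> \<open>Equality is claimed eventually only, since \<open>M n\<close> is known to be a
      probability space for \<open>n \<ge> 1\<close>.\<close>
    show "eventually (\<lambda>n. 1 - measure (M n) (bad \<epsilon> n) = measure (M n) (good \<epsilon> n)) sequentially"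
      using eventually_ge_at_top[of 1]
    proof eventually_elim
      case (elim n)
      interpret iid_matrix "M n" n A p "X n"
        by (rule matrix[OF elim])
      show ?case
        unfolding bad_eq using prob_compl[OF good_sets[OF elim]] by simp
    qed
  qed
  moreover have "(\<lambda>n. measure (M n) {\<omega> \<in> space (M n). \<bar>real (T (X n \<omega>)) / log Q (real n) - c\<bar> > \<epsilon>}) \<longlonglongrightarrow> 0"
    if "0 < \<epsilon>" for \<epsilon>
  proof (rule tendsto_sandwich[OF _ _ tendsto_const bad_tendsto[OF that]])
    show "eventually (\<lambda>n. measure (M n) {\<omega> \<in> space (M n).
        \<bar>real (T (X n \<omega>)) / log Q (real n) - c\<bar> > \<epsilon>} \<le> measure (M n) (bad \<epsilon> n)) sequentially"
      \<comment> \<open>For \<open>n > 1\<close> the logarithm is positive, so dividing by it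
        preserves the inequalities and a deviation above \<epsilon> puts \<omega> into
        \<open>bad \<epsilon> n\<close>.\<close>
      using eventually_gt_at_top[of 1]
    proof eventually_elim
      case (elim n)
      then interpret iid_matrix "M n" n A p "X n"
        by (intro matrix) simp
      have "0 < log Q n"
        using \<open>1 < Q\<close> elim by simp
      then have "{\<omega> \<in> space (M n). \<bar>real (T (X n \<omega>)) / log Q (real n) - c\<bar> > \<epsilon>} \<subseteq> bad \<epsilon> n"
        by (auto simp: bad_def abs_less_iff abs_le_iff field_simps)
      moreover have "bad \<epsilon> n \<in> events"
        unfolding bad_eq using good_sets elim by (intro sets.compl_sets) simp
      ultimately show ?case
        by (rule finite_measure_mono)
    qed
  qed simp
  ultimately show ?thesis
    unfolding converges_in_probability_def good_def c_def by blast
qed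

end
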